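(* Let $G$ be a countable monoid and let $A$ be an Artinian group (resp. an Artinian module over a ring $R$). Let $\Sigma \subset A^G$ be a subshift that is closed in the prodiscrete topology and that is also a subgroup (resp. an $R$-submodule) of $A^G$. Let $\Gamma \subset \mathrm{End}(\Sigma)$ be a finitely generated abelian submonoid consisting of $G$-equivariant group (resp. $R$-module) endomorphisms $\Sigma \to \Sigma$ that are uniformly continuous with respect to the prodiscrete uniform structure. Then the valuation action of $\Gamma$ on $\Sigma$ has the shadowing property.
   Context: A group is Artinian if every descending sequence of subgroups eventually stabilizes; a (left or right) module over a ring is Artinian if every descending sequence of submodules eventually stabilizes. $A^G$ is the set of maps $G\to A$ with pointwise operations, and the prodiscrete topology (uniform structure) is the product topology (product uniform structure) with each factor $A$ discrete. A map $\tau:\Sigma\to\Sigma$ is uniformly continuous if for every finite $E\subset G$ there is a finite $F\subset G$ such that for all $x,y\in\Sigma$, $x|_F=y|_F$ implies $\tau(x)|_E=\tau(y)|_E$. The right shift action of the monoid $G$ on $A^G$ is $(g\star x)(h)=x(hg)$ for $g,h\in G$, $x\in A^G$. A subset $\Sigma\subset A^G$ is a subshift if $g\star x\in\Sigma$ for all $g\in G$, $x\in\Sigma$. A map $\tau$ is $G$-equivariant if $\tau(g\star x)=g\star\tau(x)$. $\mathrm{End}(\Sigma)$ is the monoid of group (resp. $R$-module) endomorphisms of $\Sigma$ under composition. The valuation action $T$ of $\Gamma$ on $\Sigma$ is $T(\tau,x)=\tau(x)$. Standard Hamming metrics: let $(E_n)_{n\ge 0}$ be finite subsets of $G$ with $E_0=\varnothing$,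 $E_n\subset E_{n+1}$ and $G=\bigcup_n E_n$. The associated standard Hamming metric on $A^G$ is $d(x,y)=2^{-n}$ with $n=\sup\{k\in\mathbb{N}: x|_{E_k}=y|_{E_k}\}$ (with $2^{-\infty}=0$). Shadowing: let $T$ be an action of a finitely generated monoid $\Gamma$ on a set $X$, $S$ a finite generating set of $\Gamma$, $d$ a metric on $X$. For $\delta>0$, a family $(x_\tau)_{\tau\in\Gamma}$ in $X$ is an $(S,d,\delta)$-pseudo-orbit of $T$ if $d(T(\sigma,x_\tau),x_{\sigma\tau})<\delta$ for all $\sigma\in S$, $\tau\in\Gamma$. $T$ has the $(S,d)$-shadowing property if for every $\varepsilon>0$ there is $\delta>0$ such that for every $(S,d,\delta)$-pseudo-orbit $(x_\tau)_{\tau\in\Gamma}$ there is $x\in X$ with $d(T(\tau,x),x_\tau)<\varepsilon$ for all $\tau\in\Gamma$. An action of a finitely generated monoid $\Gamma$ on a subshift $\Sigma\subset A^G$ has the shadowing property if it has the $(S,d|_\Sigma)$-shadowing property for every finite generating set $S$ of $\Gamma$ and every standard Hamming metric $d$ on $A^G$. *)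

theory Defs
  imports
    "HOL-Analysis.Analysis"
    "HOL-Library.Extended_Nat"
    "HOL-Algebra.Algebra"
begin

section \<open>Modules over a possibly noncommutative ring\<close>

text \<open>The library locale \<open>module\<close> is restricted to commutative rings. Both kinds of one-sided
  module use the library record; for a right module, \<open>r \<odot>\<^bsub>M\<^esub> x\<close> stands for \<open>x\<cdot>r\<close>.\<close>

locale left_module = R?: ring R + M?: abelian_group M
  for R :: "('r, 'k) ring_scheme" (structure)
    and M :: "('r, 'a, 'l) module_scheme" (structure) +
  assumes smult_closed: "\<lbrakk>r \<in> carrier R; x \<in> carrier M\<rbrakk> \<Longrightarrow> r \<odot>\<^bsub>M\<^esub> x \<in> carrier M"
    and smult_l_distr: "\<lbrakk>r \<in> carrier R; s \<in> carrier R; x \<in> carrier M\<rbrakk>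
      \<Longrightarrow> (r \<oplus>\<^bsub>R\<^esub> s) \<odot>\<^bsub>M\<^esub> x = r \<odot>\<^bsub>M\<^esub> x \<oplus>\<^bsub>M\<^esub> s \<odot>\<^bsub>M\<^esub> x"
    and smult_r_distr: "\<lbrakk>r \<in> carrier R; x \<in> carrier M; y \<in> carrier M\<rbrakk>
      \<Longrightarrow> r \<odot>\<^bsub>M\<^esub> (x \<oplus>\<^bsub>M\<^esub> y) = r \<odot>\<^bsub>M\<^esub> x \<oplus>\<^bsub>M\<^esub> r \<odot>\<^bsub>M\<^esub> y"
    and smult_assoc: "\<lbrakk>r \<in> carrier R; s \<in> carrier R; x \<in> carrier M\<rbrakk>
      \<Longrightarrow> (r \<otimes>\<^bsub>R\<^esub> s) \<odot>\<^bsub>M\<^esub> x = r \<odot>\<^bsub>M\<^esub> (s \<odot>\<^bsub>M\<^esub> x)"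
    and smult_one: "x \<in> carrier M \<Longrightarrow> \<one>\<^bsub>R\<^esub> \<odot>\<^bsub>M\<^esub> x = x"

locale right_module = R?: ring R + M?: abelian_group M
  for R :: "('r, 'k) ring_scheme" (structure)
    and M :: "('r, 'a, 'l) module_scheme" (structure) +
  assumes smult_closed: "\<lbrakk>r \<in> carrier R; x \<in> carrier M\<rbrakk> \<Longrightarrow> r \<odot>\<^bsub>M\<^esub> x \<in> carrier M"
    and smult_l_distr: "\<lbrakk>r \<in> carrier R; s \<in> carrier R; x \<in> carrier M\<rbrakk>
      \<Longrightarrow> (r \<oplus>\<^bsub>R\<^esub> s) \<odot>\<^bsub>M\<^esub> x = r \<odot>\<^bsub>M\<^esub> x \<oplus>\<^bsub>M\<^esub> s \<odot>\<^bsub>M\<^esub> x"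
    and smult_r_distr: "\<lbrakk>r \<in> carrier R; x \<in> carrier M; y \<in> carrier M\<rbrakk>
      \<Longrightarrow> r \<odot>\<^bsub>M\<^esub> (x \<oplus>\<^bsub>M\<^esub> y) = r \<odot>\<^bsub>M\<^esub> x \<oplus>\<^bsub>M\<^esub> r \<odot>\<^bsub>M\<^esub> y"
    and smult_assoc: "\<lbrakk>r \<in> carrier R; s \<in> carrier R; x \<in> carrier M\<rbrakk>
      \<Longrightarrow> (r \<otimes>\<^bsub>R\<^esub> s) \<odot>\<^bsub>M\<^esub> x = s \<odot>\<^bsub>M\<^esub> (r \<odot>\<^bsub>M\<^esub> x)"
    and smult_one: "x \<in> carrier M \<Longrightarrow> \<one>\<^bsub>R\<^esub> \<odot>\<^bsub>M\<^esub> x = x"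

text \<open>The library predicate \<open>submodule H R M\<close> only says that \<open>H\<close> is an additive subgroup stable
  under scalars, so it is meaningful on both sides and over any ring.\<close>

definition artinian_group :: "('a, 'm) monoid_scheme \<Rightarrow> bool" where
  "artinian_group A \<longleftrightarrow> group A \<and>
     (\<forall>H :: nat \<Rightarrow> 'a set. (\<forall>n. subgroup (H n) A) \<and> decseq H \<longrightarrow> (\<exists>N. \<forall>n\<ge>N. H n = H N))"

definition artinian_module :: "('r, 'k) ring_scheme \<Rightarrow> ('r, 'a, 'l) module_scheme \<Rightarrow> bool" where
  "artinian_module R M \<longleftrightarrow> (left_module R M \<or> right_module R M) \<and>
     (\<forall>H :: nat \<Rightarrow> 'a set. (\<forall>n. submodule (H n) R M) \<and> decseq H \<longrightarrow> (\<exists>N. \<forall>n\<ge>N. H n = H N))"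

section \<open>Configuration spaces\<close>

text \<open>Configurations are maps \<open>x\<close> in \<open>carrier G \<rightarrow>\<^sub>E carrier A\<close>, hence undefined outside
  \<open>carrier G\<close>. For a group \<open>A\<close> the group structure is the library's \<open>product_group\<close>.
  In the module case the fields \<open>mult\<close> and \<open>one\<close> below are irrelevant; they are only required by
  the record type.\<close>

definition power_group :: "('g, 'x) monoid_scheme \<Rightarrow> ('a, 'm) monoid_scheme \<Rightarrow> ('g \<Rightarrow> 'a) monoid" where
  "power_group G A = product_group (carrier G) (\<lambda>_. A)"

definition power_module ::
    "('g, 'x) monoid_scheme \<Rightarrow> ('r, 'a, 'l) module_scheme \<Rightarrow> ('r, 'g \<Rightarrow> 'a) module" where
  "power_module G M =
     \<lparr>carrier = carrier G \<rightarrow>\<^sub>E carrier M,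
      monoid.mult = (\<lambda>x y. \<lambda>g\<in>carrier G. x g \<otimes>\<^bsub>M\<^esub> y g),
      one = (\<lambda>g\<in>carrier G. \<one>\<^bsub>M\<^esub>),
      ring.zero = (\<lambda>g\<in>carrier G. \<zero>\<^bsub>M\<^esub>),
      add = (\<lambda>x y. \<lambda>g\<in>carrier G. x g \<oplus>\<^bsub>M\<^esub> y g),
      smult = (\<lambda>r x. \<lambda>g\<in>carrier G. r \<odot>\<^bsub>M\<^esub> x g)\<rparr>"

definition prodiscrete_topology :: "('g, 'x) monoid_scheme \<Rightarrow> 'a set \<Rightarrow> ('g \<Rightarrow> 'a) topology" where
  "prodiscrete_topology G A = product_topology (\<lambda>_. discrete_topology A) (carrier G)"

definition shift :: "('g, 'x) monoid_scheme \<Rightarrow> 'g \<Rightarrow> ('g \<Rightarrow> 'a) \<Rightarrow> 'g \<Rightarrow> 'a" where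
  "shift G g x = (\<lambda>h\<in>carrier G. x (h \<otimes>\<^bsub>G\<^esub> g))"

definition subshift :: "('g, 'x) monoid_scheme \<Rightarrow> 'a set \<Rightarrow> ('g \<Rightarrow> 'a) set \<Rightarrow> bool" where
  "subshift G A \<Sigma> \<longleftrightarrow> \<Sigma> \<subseteq> (carrier G \<rightarrow>\<^sub>E A) \<and> (\<forall>g\<in>carrier G. \<forall>x\<in>\<Sigma>. shift G g x \<in> \<Sigma>)"

definition shift_equivariant ::
    "('g, 'x) monoid_scheme \<Rightarrow> ('g \<Rightarrow> 'a) set \<Rightarrow> (('g \<Rightarrow> 'a) \<Rightarrow> 'g \<Rightarrow> 'a) \<Rightarrow> bool" where
  "shift_equivariant G \<Sigma> \<tau> \<longleftrightarrow>
     (\<forall>g\<in>carrier G. \<forall>x\<in>\<Sigma>. \<tau> (shift G g x) = shift G g (\<tau> x))"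

definition prodiscrete_uniformly_continuous ::
    "('g, 'x) monoid_scheme \<Rightarrow> ('g \<Rightarrow> 'a) set \<Rightarrow> (('g \<Rightarrow> 'a) \<Rightarrow> 'g \<Rightarrow> 'a) \<Rightarrow> bool" where
  "prodiscrete_uniformly_continuous G \<Sigma> \<tau> \<longleftrightarrow>
     (\<forall>E. finite E \<and> E \<subseteq> carrier G \<longrightarrow>
       (\<exists>F. finite F \<and> F \<subseteq> carrier G \<and>
         (\<forall>x\<in>\<Sigma>. \<forall>y\<in>\<Sigma>. (\<forall>g\<in>F. x g = y g) \<longrightarrow> (\<forall>g\<in>E. \<tau> x g = \<tau> y g))))"

section \<open>Endomorphism monoids\<close>

text \<open>Endomorphisms are taken extensional on the carrier, so that two of them are equal as HOL
  functions iff they agree on the carrier.\<close>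

definition group_End :: "('a, 'm) monoid_scheme \<Rightarrow> ('a \<Rightarrow> 'a) monoid" where
  "group_End H =
     \<lparr>carrier = hom H H \<inter> extensional (carrier H),
      monoid.mult = (\<lambda>\<sigma> \<tau>. compose (carrier H) \<sigma> \<tau>),
      one = (\<lambda>x\<in>carrier H. x)\<rparr>"

definition module_End :: "('r, 'k) ring_scheme \<Rightarrow> ('r, 'a, 'l) module_scheme \<Rightarrow> ('a \<Rightarrow> 'a) monoid" where
  "module_End R M =
     \<lparr>carrier = {\<tau> \<in> hom (add_monoid M) (add_monoid M) \<inter> extensional (carrier M).
                  \<forall>r\<in>carrier R. \<forall>x\<in>carrier M. \<tau> (r \<odot>\<^bsub>M\<^esub> x) = r \<odot>\<^bsub>M\<^esub> \<tau> x},
      monoid.mult = (\<lambda>\<sigma> \<tau>. compose (carrier M) \<sigma> \<tau>),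
      one = (\<lambda>x\<in>carrier M. x)\<rparr>"

section \<open>Finitely generated monoids\<close>

inductive_set monoid_generate :: "('t, 'm) monoid_scheme \<Rightarrow> 't set \<Rightarrow> 't set" for \<Gamma> S where
  one: "\<one>\<^bsub>\<Gamma>\<^esub> \<in> monoid_generate \<Gamma> S"
| incl: "\<sigma> \<in> S \<Longrightarrow> \<sigma> \<in> monoid_generate \<Gamma> S"
| mult: "\<lbrakk>\<sigma> \<in> monoid_generate \<Gamma> S; \<tau> \<in> monoid_generate \<Gamma> S\<rbrakk> \<Longrightarrow> \<sigma> \<otimes>\<^bsub>\<Gamma>\<^esub> \<tau> \<in> monoid_generate \<Gamma> S"

definition finite_generating_set :: "('t, 'm) monoid_scheme \<Rightarrow> 't set \<Rightarrow> bool" where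
  "finite_generating_set \<Gamma> S \<longleftrightarrow> finite S \<and> S \<subseteq> carrier \<Gamma> \<and> monoid_generate \<Gamma> S = carrier \<Gamma>"

definition finitely_generated_monoid :: "('t, 'm) monoid_scheme \<Rightarrow> bool" where
  "finitely_generated_monoid \<Gamma> \<longleftrightarrow> monoid \<Gamma> \<and> (\<exists>S. finite_generating_set \<Gamma> S)"

section \<open>Standard Hamming metrics\<close>

definition exhaustion :: "('g, 'x) monoid_scheme \<Rightarrow> (nat \<Rightarrow> 'g set) \<Rightarrow> bool" where
  "exhaustion G E \<longleftrightarrow> (\<forall>n. finite (E n)) \<and> E 0 = {} \<and> (\<forall>n. E n \<subseteq> E (Suc n)) \<and>
     (\<Union>n. E n) = carrier G"

text \<open>The supremum is taken in \<open>\<nat> \<union> {\<infinity>}\<close>.\<close>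

definition hamming_metric :: "(nat \<Rightarrow> 'g set) \<Rightarrow> ('g \<Rightarrow> 'a) \<Rightarrow> ('g \<Rightarrow> 'a) \<Rightarrow> real" where
  "hamming_metric E x y =
     (case (SUP k \<in> {k. \<forall>g\<in>E k. x g = y g}. enat k) of enat n \<Rightarrow> 1 / 2 ^ n | \<infinity> \<Rightarrow> 0)"

section \<open>Shadowing\<close>

definition pseudo_orbit ::
    "('t, 'm) monoid_scheme \<Rightarrow> 'p set \<Rightarrow> ('t \<Rightarrow> 'p \<Rightarrow> 'p) \<Rightarrow> 't set \<Rightarrow> ('p \<Rightarrow> 'p \<Rightarrow> real) \<Rightarrow> real
      \<Rightarrow> ('t \<Rightarrow> 'p) \<Rightarrow> bool" where
  "pseudo_orbit \<Gamma> Y T S d \<delta> p \<longleftrightarrow>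
     (\<forall>\<tau>\<in>carrier \<Gamma>. p \<tau> \<in> Y) \<and>
     (\<forall>\<sigma>\<in>S. \<forall>\<tau>\<in>carrier \<Gamma>. d (T \<sigma> (p \<tau>)) (p (\<sigma> \<otimes>\<^bsub>\<Gamma>\<^esub> \<tau>)) < \<delta>)"

definition metric_shadowing_property ::
    "('t, 'm) monoid_scheme \<Rightarrow> 'p set \<Rightarrow> ('t \<Rightarrow> 'p \<Rightarrow> 'p) \<Rightarrow> 't set \<Rightarrow> ('p \<Rightarrow> 'p \<Rightarrow> real) \<Rightarrow> bool" where
  "metric_shadowing_property \<Gamma> Y T S d \<longleftrightarrow>
     (\<forall>\<epsilon>>0. \<exists>\<delta>>0. \<forall>p. pseudo_orbit \<Gamma> Y T S d \<delta> p \<longrightarrow>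
        (\<exists>x\<in>Y. \<forall>\<tau>\<in>carrier \<Gamma>. d (T \<tau> x) (p \<tau>) < \<epsilon>))"

definition shadowing_property ::
    "('g, 'x) monoid_scheme \<Rightarrow> ('t, 'm) monoid_scheme \<Rightarrow> ('g \<Rightarrow> 'a) set
      \<Rightarrow> ('t \<Rightarrow> ('g \<Rightarrow> 'a) \<Rightarrow> 'g \<Rightarrow> 'a) \<Rightarrow> bool" where
  "shadowing_property G \<Gamma> \<Sigma> T \<longleftrightarrow>
     (\<forall>S E. finite_generating_set \<Gamma> S \<and> exhaustion G E \<longrightarrow>
        metric_shadowing_property \<Gamma> \<Sigma> T S (hamming_metric E))"

definition valuation_action :: "('p \<Rightarrow> 'p) \<Rightarrow> 'p \<Rightarrow> 'p" where
  "valuation_action \<tau> x = \<tau> x"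

end

(*
  Groups and modules are treated together as groups with operators (no operators in the group
  case). A surjection from a free commutative monoid onto Gamma, written pi, identifies the free
  monoid with the positive integers whose prime factors lie in a finite set Q: the usual order is
  then a multiplicative well-order and divisibility is the componentwise order of Dickson's lemma.

  Fix a finite window E. Let T(v) be the set of x in Sigma with pi(u)(x) trivial on E for all
  u < v. The leading images pi(v)(T(v)), restricted to E, decrease along divisibility, and the
  subgroups of A^E satisfy the descending chain condition, so there is a bound M such that each
  leading image already occurs at a divisor w <= M of v. Hence the families (pi(u)(x)|E), for x in
  Sigma, form a system of finite type: a family which is realised on all translates of the window
  {u. u <= M} is realised on every initial segment, by correcting a partial solution at v with an
  element of T(v), and then everywhere, by linear compactness of Sigma. A sufficiently precise
  pseudo-orbit is exact on such windows.
*)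
theory Submission
  imports Defs
begin

section \<open>Dickson's lemma for smooth numbers\<close>

text \<open>Positivity is a separate condition because \<open>prime_factors 0\<close> is empty. For
  a set \<open>Q\<close> of primes, the exponents identify these numbers with the free commutative
  monoid on \<open>Q\<close>.\<close>

definition smooth_numbers :: "nat set \<Rightarrow> nat set" where
  "smooth_numbers Q = {n. n > 0 \<and> prime_factors n \<subseteq> Q}"

lemma smooth_numbers_one: "1 \<in> smooth_numbers Q"
  by (simp add: smooth_numbers_def)

lemma smooth_numbers_mult:
  "m * n \<in> smooth_numbers Q \<longleftrightarrow> m \<in> smooth_numbers Q \<and> n \<in> smooth_numbers Q"
  by (cases "m = 0 \<or> n = 0") (auto simp: smooth_numbers_def prime_factors_product)

text \<open>Some subsequence is monotone; a decreasing one reaches its minimum and is constant from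
  there on, so dropping a finite beginning makes it increasing.\<close>

lemma incseq_subsequence_nat:
  fixes s :: "nat \<Rightarrow> nat"
  obtains r :: "nat \<Rightarrow> nat" where "strict_mono r" "incseq (s \<circ> r)"
proof -
  obtain f where f: "strict_mono f" "monoseq (\<lambda>n. s (f n))"
    using seq_monosub by blast
  show thesis
  proof (cases "incseq (\<lambda>n. s (f n))")
    case True
    with f that show thesis by (auto simp: comp_def)
  next
    case False
    then have dec: "decseq (\<lambda>n. s (f n))"
      using f(2) by (auto simp: monoseq_iff)
    define k where "k = (LEAST k. k \<in> range (\<lambda>n. s (f n)))"
    have k: "k \<in> range (\<lambda>n. s (f n))" "\<And>n. k \<le> s (f n)"
      unfolding k_def by (rule LeastI, rule rangeI) (rule Least_le, rule rangeI)
    then obtain N where N: "s (f N) = k" by auto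
    have "s (f (n + N)) = k" for n
      using k(2)[of "n + N"] N decseqD[OF dec, of N "n + N"] by auto
    then have "incseq (s \<circ> (\<lambda>n. f (n + N)))"
      by (simp add: incseq_def)
    moreover have "strict_mono (\<lambda>n. f (n + N))"
      using f(1) by (simp add: strict_mono_def)
    ultimately show thesis using that by blast
  qed
qed

text \<open>Dickson's lemma for sequences. The subsequence is refined one coordinate at a time, and
  the refinement keeps the coordinates treated before increasing.\<close>

lemma dickson_subsequence:
  fixes f :: "nat \<Rightarrow> 'q \<Rightarrow> nat"
  assumes "finite Q"
  shows "\<exists>r :: nat \<Rightarrow> nat. strict_mono r \<and> (\<forall>p\<in>Q. incseq (\<lambda>i. f (r i) p))"
  using assms
proof (induction Q rule: finite_induct)
  case empty
  show ?case by (rule exI[of _ id]) (simp add: strict_mono_def)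
next
  case (insert q Q)
  then obtain r where r: "strict_mono r" "\<forall>p\<in>Q. incseq (\<lambda>i. f (r i) p)" by blast
  obtain t where t: "strict_mono t" "incseq ((\<lambda>i. f (r i) q) \<circ> t)"
    by (rule incseq_subsequence_nat)
  have "incseq (\<lambda>i. f ((r \<circ> t) i) p)" if "p \<in> Q" for p
    using r(2) that strict_mono_mono[OF t(1)] by (auto simp: incseq_def mono_def)
  then show ?case
    using strict_mono_o[OF r(1) t(1)] t(2) by (intro exI[of _ "r \<circ> t"]) (auto simp: comp_def)
qed

text \<open>Between smooth numbers, divisibility is the componentwise order of the exponents at
  \<open>Q\<close>, since every prime outside \<open>Q\<close> has multiplicity zero.\<close>

lemma smooth_dvd_subsequence:
  fixes v :: "nat \<Rightarrow> nat"
  assumes "finite Q" and v: "\<And>n. v n \<in> smooth_numbers Q"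
  obtains r :: "nat \<Rightarrow> nat" where "strict_mono r" "\<And>i j. i \<le> j \<Longrightarrow> v (r i) dvd v (r j)"
proof -
  obtain r :: "nat \<Rightarrow> nat" where r: "strict_mono r" "\<forall>p\<in>Q. incseq (\<lambda>i. multiplicity p (v (r i)))"
    using dickson_subsequence[OF \<open>finite Q\<close>, of "\<lambda>n p. multiplicity p (v n)"] by blast
  have "v (r i) dvd v (r j)" if "i \<le> j" for i j
  proof (rule multiplicity_le_imp_dvd)
    show "v (r i) \<noteq> 0" using v[of "r i"] by (simp add: smooth_numbers_def)
    fix p :: nat assume "Factorial_Ring.prime p"
    show "multiplicity p (v (r i)) \<le> multiplicity p (v (r j))"
    proof (cases "p \<in> Q")
      case True
      then show ?thesis using r(2) that by (auto simp: incseq_def)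
    next
      case False
      then have "p \<notin> prime_factors (v (r i))" using v[of "r i"] by (auto simp: smooth_numbers_def)
      then have "\<not> p dvd v (r i)" using \<open>Factorial_Ring.prime p\<close> v[of "r i"]
        by (auto simp: smooth_numbers_def prime_factors_dvd)
      then show ?thesis by (simp add: not_dvd_imp_multiplicity_0)
    qed
  qed
  with r(1) that show thesis by blast
qed

text \<open>Below, \<open>R K L\<close> is instantiated with ``\<open>K\<close> and \<open>L\<close> have the same restriction to a finite
  window'', given \<open>L \<subseteq> K\<close>. Were there no bound \<open>M\<close>, one could choose indices \<open>v 0 < v 1 < \<dots>\<close>, each
  with a value not attained at a divisor up to the preceding index; Dickson's lemma turns them into
  a divisibility chain, hence into a decreasing sequence that never stabilises.\<close>

lemma bounded_stable_divisors:
  fixes H :: "nat \<Rightarrow> 'h set"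
  assumes "finite Q"
    and dcc: "\<And>K. (\<And>n. K n \<in> H ` smooth_numbers Q) \<Longrightarrow> decseq K \<Longrightarrow> \<exists>n. R (K n) (K (Suc n))"
    and refl: "\<And>v. v \<in> smooth_numbers Q \<Longrightarrow> R (H v) (H v)"
    and anti: "\<And>v w. v \<in> smooth_numbers Q \<Longrightarrow> w \<in> smooth_numbers Q \<Longrightarrow> v dvd w \<Longrightarrow> H w \<subseteq> H v"
  shows "\<exists>M. \<forall>v\<in>smooth_numbers Q. \<exists>w. w dvd v \<and> w \<le> M \<and> R (H w) (H v)"
proof (rule ccontr)
  assume "\<not> ?thesis"
  then have "\<forall>M. \<exists>v. v \<in> smooth_numbers Q \<and> (\<forall>w. w dvd v \<longrightarrow> w \<le> M \<longrightarrow> \<not> R (H w) (H v))"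
    by blast
  then obtain g where g: "\<And>M. g M \<in> smooth_numbers Q"
      "\<And>M w. w dvd g M \<Longrightarrow> w \<le> M \<Longrightarrow> \<not> R (H w) (H (g M))"
    by metis
  \<comment> \<open>Iteration of \<open>g\<close> makes each term a counterexample to the bound
    given by the preceding term.\<close>
  define v where "v = rec_nat (g 0) (\<lambda>_. g)"
  have v_Suc: "v (Suc n) = g (v n)" for n by (simp add: v_def)
  have v: "v n \<in> smooth_numbers Q" for n by (cases n) (simp_all add: v_def g(1))
  \<comment> \<open>By reflexivity \<open>v (Suc n)\<close> attains its own value, so as a divisor
    of itself it cannot be at most \<open>v n\<close>.\<close>
  have "v n < v (Suc n)" for n
    using g(2)[of "v (Suc n)" "v n"] refl[OF v, of "Suc n"] unfolding v_Suc by force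
  then have v_mono: "strict_mono v" by (simp add: strict_mono_Suc_iff)
  obtain r :: "nat \<Rightarrow> nat" where r: "strict_mono r" "\<And>i j. i \<le> j \<Longrightarrow> v (r i) dvd v (r j)"
    using smooth_dvd_subsequence[OF \<open>finite Q\<close>, of v] v by metis
  have "decseq (\<lambda>i. H (v (r i)))"
    unfolding decseq_def using anti v r(2) by blast
  then obtain n where n: "R (H (v (r n))) (H (v (r (Suc n))))"
    using dcc[of "\<lambda>i. H (v (r i))"] v by auto
  \<comment> \<open>The index \<open>k\<close> just before \<open>r (Suc n)\<close> gives the bound
    \<open>v k\<close> used to choose \<open>v (Suc k)\<close>. The divisor \<open>v (r n)\<close>
    respects this bound, so its value should not recur.\<close>
  have "r n < r (Suc n)" using r(1) by (simp add: strict_mono_Suc_iff)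
  then obtain k where k: "r (Suc n) = Suc k" "r n \<le> k" by (cases "r (Suc n)") auto
  have "v (r n) \<le> v k" using k(2) v_mono by (simp add: strict_mono_less_eq)
  then show False
    using g(2)[of "v (r n)" "v k"] r(2)[of n "Suc n"] n k(1) by (simp add: v_Suc)
qed

section \<open>Closed subgroups of powers of Artinian operator groups\<close>

text \<open>Common frame for groups and modules. The chain condition concerns only operator-stable
  subgroups, and closedness is stated through approximation on finite windows, the form in which
  limits are constructed.\<close>

locale operator_power =
  fixes A :: "('a, 'm) monoid_scheme" (structure)
    and Om :: "'r set" and act :: "'r \<Rightarrow> 'a \<Rightarrow> 'a"
    and I :: "'g set" and \<Sigma> :: "('g \<Rightarrow> 'a) set"
  assumes group_A: "group A"
    and act_hom: "r \<in> Om \<Longrightarrow> act r \<in> hom A A"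
    and dcc: "(\<And>n. subgroup (H n) A) \<Longrightarrow> (\<And>n r x. r \<in> Om \<Longrightarrow> x \<in> H n \<Longrightarrow> act r x \<in> H n)
      \<Longrightarrow> decseq H \<Longrightarrow> \<exists>N. \<forall>n\<ge>N. H n = H N"
    and subgroup_\<Sigma>: "subgroup \<Sigma> (product_group I (\<lambda>_. A))"
    and act_\<Sigma>: "r \<in> Om \<Longrightarrow> x \<in> \<Sigma> \<Longrightarrow> (\<lambda>i\<in>I. act r (x i)) \<in> \<Sigma>"
    and countable_I: "countable I"
    and closed_\<Sigma>: "x \<in> I \<rightarrow>\<^sub>E carrier A \<Longrightarrow>
      (\<And>F. finite F \<Longrightarrow> F \<subseteq> I \<Longrightarrow> \<exists>z\<in>\<Sigma>. \<forall>i\<in>F. z i = x i) \<Longrightarrow> x \<in> \<Sigma>"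
begin

section \<open>Operator subgroups and operator endomorphisms\<close>

definition W where "W = (product_group I (\<lambda>_. A))\<lparr>carrier := \<Sigma>\<rparr>"

definition pact where "pact r x = (\<lambda>i\<in>I. act r (x i))"

text \<open>In the module case these are the submodules of \<Sigma>. Their projections to one
  coordinate are the subgroups to which \<open>dcc\<close> applies.\<close>

definition admissible where
  "admissible K \<longleftrightarrow> subgroup K W \<and> (\<forall>r\<in>Om. \<forall>x\<in>K. pact r x \<in> K)"

definition operator_endos where
  "operator_endos = {\<tau> \<in> hom W W. \<forall>r\<in>Om. \<forall>x\<in>\<Sigma>. \<tau> (pact r x) = pact r (\<tau> x)}"

sublocale A: group A by (fact group_A)

lemma group_power: "group (product_group I (\<lambda>_. A))"
  by (simp add: group_A)

sublocale W: group W
  unfolding W_def by (rule subgroup.subgroup_is_group[OF subgroup_\<Sigma> group_power])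

lemma carrier_W [simp]: "carrier W = \<Sigma>"
  by (simp add: W_def)

lemma \<Sigma>_PiE: "x \<in> \<Sigma> \<Longrightarrow> x \<in> I \<rightarrow>\<^sub>E carrier A"
  using subgroup.subset[OF subgroup_\<Sigma>] by auto

lemma \<Sigma>_apply [simp]: "x \<in> \<Sigma> \<Longrightarrow> i \<in> I \<Longrightarrow> x i \<in> carrier A"
  using \<Sigma>_PiE by (auto simp: PiE_iff)

lemma mult_apply: "i \<in> I \<Longrightarrow> (x \<otimes>\<^bsub>W\<^esub> y) i = x i \<otimes> y i"
  by (simp add: W_def)

lemma one_apply: "i \<in> I \<Longrightarrow> \<one>\<^bsub>W\<^esub> i = \<one>"
  by (simp add: W_def)

lemma inv_apply:
  assumes x: "x \<in> \<Sigma>" and i: "i \<in> I"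
  shows "(inv\<^bsub>W\<^esub> x) i = inv (x i)"
proof -
  have "inv\<^bsub>W\<^esub> x = inv\<^bsub>product_group I (\<lambda>_. A)\<^esub> x"
    unfolding W_def by (rule group.m_inv_consistent[OF group_power subgroup_\<Sigma> x])
  also have "\<dots> = (\<lambda>i\<in>I. inv (x i))"
    by (rule inv_product_group[OF \<Sigma>_PiE[OF x] group_A])
  finally show ?thesis using i by simp
qed

lemma diff_eq_one_iff:
  assumes "x \<in> \<Sigma>" "y \<in> \<Sigma>" "i \<in> I"
  shows "(inv\<^bsub>W\<^esub> x \<otimes>\<^bsub>W\<^esub> y) i = \<one> \<longleftrightarrow> x i = y i"
proof -
  have "x i \<in> carrier A" "y i \<in> carrier A" using assms by auto
  then have "inv (x i) \<otimes> y i = \<one> \<longleftrightarrow> x i = y i"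
    by (metis A.inv_closed A.inv_equality A.inv_inv A.l_inv)
  then show ?thesis using assms by (simp add: mult_apply inv_apply)
qed

lemma admissibleD:
  assumes "admissible K"
  shows "subgroup K W" "K \<subseteq> \<Sigma>" "x \<in> K \<Longrightarrow> y \<in> K \<Longrightarrow> x \<otimes>\<^bsub>W\<^esub> y \<in> K" "x \<in> K \<Longrightarrow> inv\<^bsub>W\<^esub> x \<in> K"
    "\<one>\<^bsub>W\<^esub> \<in> K" "r \<in> Om \<Longrightarrow> x \<in> K \<Longrightarrow> pact r x \<in> K"
  using assms subgroup.subset[of K W]
  by (auto simp: admissible_def subgroup.m_closed subgroup.m_inv_closed subgroup.one_closed)

lemma admissibleI:
  assumes "K \<subseteq> \<Sigma>" "\<one>\<^bsub>W\<^esub> \<in> K" "\<And>x y. x \<in> K \<Longrightarrow> y \<in> K \<Longrightarrow> x \<otimes>\<^bsub>W\<^esub> y \<in> K" "\<And>x. x \<in> K \<Longrightarrow> inv\<^bsub>W\<^esub> x \<in> K"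
    "\<And>r x. r \<in> Om \<Longrightarrow> x \<in> K \<Longrightarrow> pact r x \<in> K"
  shows "admissible K"
  unfolding admissible_def using assms by (auto intro!: W.subgroupI)

lemma pact_apply: "i \<in> I \<Longrightarrow> pact r x i = act r (x i)"
  by (simp add: pact_def)

lemma act_one: "r \<in> Om \<Longrightarrow> act r \<one> = \<one>"
  by (rule hom_one[OF act_hom group_A group_A])

lemma admissible_\<Sigma>: "admissible \<Sigma>"
  by (rule admissibleI) (use W.m_closed W.inv_closed W.one_closed act_\<Sigma> in \<open>auto simp: pact_def\<close>)

lemma endo_simps:
  assumes "\<tau> \<in> operator_endos"
  shows "x \<in> \<Sigma> \<Longrightarrow> \<tau> x \<in> \<Sigma>"
    "x \<in> \<Sigma> \<Longrightarrow> y \<in> \<Sigma> \<Longrightarrow> \<tau> (x \<otimes>\<^bsub>W\<^esub> y) = \<tau> x \<otimes>\<^bsub>W\<^esub> \<tau> y"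
    "x \<in> \<Sigma> \<Longrightarrow> \<tau> (inv\<^bsub>W\<^esub> x) = inv\<^bsub>W\<^esub> (\<tau> x)"
    "\<tau> \<one>\<^bsub>W\<^esub> = \<one>\<^bsub>W\<^esub>"
    "r \<in> Om \<Longrightarrow> x \<in> \<Sigma> \<Longrightarrow> \<tau> (pact r x) = pact r (\<tau> x)"
proof -
  have "\<tau> \<in> hom W W" using assms by (simp add: operator_endos_def)
  then interpret h: group_hom W W \<tau> by unfold_locales
  show "x \<in> \<Sigma> \<Longrightarrow> \<tau> x \<in> \<Sigma>"
    "x \<in> \<Sigma> \<Longrightarrow> y \<in> \<Sigma> \<Longrightarrow> \<tau> (x \<otimes>\<^bsub>W\<^esub> y) = \<tau> x \<otimes>\<^bsub>W\<^esub> \<tau> y"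
    "x \<in> \<Sigma> \<Longrightarrow> \<tau> (inv\<^bsub>W\<^esub> x) = inv\<^bsub>W\<^esub> (\<tau> x)"
    "\<tau> \<one>\<^bsub>W\<^esub> = \<one>\<^bsub>W\<^esub>"
    using h.hom_closed[of x] h.hom_mult[of x y] h.hom_inv[of x] h.hom_one by auto
  show "r \<in> Om \<Longrightarrow> x \<in> \<Sigma> \<Longrightarrow> \<tau> (pact r x) = pact r (\<tau> x)"
    using assms by (simp add: operator_endos_def)
qed

lemma admissible_image:
  assumes K: "admissible K" and \<tau>: "\<tau> \<in> operator_endos"
  shows "admissible (\<tau> ` K)"
proof -
  note D = admissibleD[OF K]
  note s = endo_simps[OF \<tau>]
  have K': "\<And>x. x \<in> K \<Longrightarrow> x \<in> \<Sigma>" using D(2) by blast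
  show ?thesis
  proof (rule admissibleI)
    show "\<tau> ` K \<subseteq> \<Sigma>" using K' s(1) by blast
    show "\<one>\<^bsub>W\<^esub> \<in> \<tau> ` K" using D(5) s(4) by (metis imageI)
    show "x \<otimes>\<^bsub>W\<^esub> y \<in> \<tau> ` K" if "x \<in> \<tau> ` K" "y \<in> \<tau> ` K" for x y
      using that s(2) D(3) K' by (smt (verit) image_iff)
    show "inv\<^bsub>W\<^esub> x \<in> \<tau> ` K" if "x \<in> \<tau> ` K" for x
      using that s(3) D(4) K' by (smt (verit) image_iff)
    show "pact r x \<in> \<tau> ` K" if "r \<in> Om" "x \<in> \<tau> ` K" for r x
      using that s(5) D(6) K' by (smt (verit) image_iff)
  qed
qed

text \<open>Used twice: with the identity it yields kernels of restrictions to a window, with an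
  initial segment of the acting monoid it yields the initial kernels.\<close>

lemma admissible_fiber:
  assumes "admissible K" and \<tau>: "\<And>u. u \<in> U \<Longrightarrow> \<tau> u \<in> operator_endos" and "E \<subseteq> I"
  shows "admissible {x \<in> K. \<forall>u\<in>U. \<forall>i\<in>E. \<tau> u x i = \<one>}"
proof -
  note D = admissibleD[OF assms(1)]
  have [simp]: "\<And>x. x \<in> K \<Longrightarrow> x \<in> \<Sigma>" using D(2) by blast
  have [simp]: "\<And>i. i \<in> E \<Longrightarrow> i \<in> I" using \<open>E \<subseteq> I\<close> by blast
  show ?thesis
    by (rule admissibleI)
      (use D in \<open>auto simp: endo_simps[OF \<tau>] mult_apply one_apply inv_apply pact_apply act_one\<close>)
qed

section \<open>Chain conditions on finite windows and linear compactness\<close>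

lemma id_endo: "(\<lambda>x. x) \<in> operator_endos"
  by (auto simp: operator_endos_def hom_def)

text \<open>The descending chain condition for the power of \<open>A\<close> over a finite window. A
  new coordinate is an extension problem: the restrictions to \<open>E\<close> stabilise by
  induction, the values at \<open>g\<close> of elements trivial on \<open>E\<close> stabilise by
  \<open>dcc\<close>, and both together control \<open>insert g E\<close>.\<close>

lemma dcc_restriction:
  assumes "finite E" "E \<subseteq> I" "\<And>n. admissible (K n)" "decseq K"
  shows "\<exists>N. \<forall>n\<ge>N. \<forall>x\<in>K N. \<exists>z\<in>K n. \<forall>i\<in>E. z i = x i"
  using assms
proof (induction E rule: finite_induct)
  case empty
  then show ?case using admissibleD(5) by auto
next
  case (insert g E)
  note D = admissibleD[OF insert.prems(2)]
  have K\<Sigma>: "\<And>n x. x \<in> K n \<Longrightarrow> x \<in> \<Sigma>" using D(2) by blast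
  have gI: "g \<in> I" and EI: "\<And>i. i \<in> E \<Longrightarrow> i \<in> I" using insert.prems(1) by auto
  obtain N where N: "\<And>n x. n \<ge> N \<Longrightarrow> x \<in> K N \<Longrightarrow> \<exists>z\<in>K n. \<forall>i\<in>E. z i = x i"
    using insert by blast
  define L where "L n = {x \<in> K n. \<forall>i\<in>E. x i = \<one>}" for n
  have adm_L: "admissible (L n)" for n
    \<comment> \<open>The fibre is taken for a one-element family consisting of the
      identity.\<close>
    using admissible_fiber[OF insert.prems(2), of "{()}" "\<lambda>_ x. x" E n] id_endo EI
    by (auto simp: L_def subset_iff)
  note DL = admissibleD[OF adm_L]
  have L\<Sigma>: "\<And>n x. x \<in> L n \<Longrightarrow> x \<in> \<Sigma>" using DL(2) by blast
  have dec_L: "decseq L"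
    using insert.prems(3) by (auto simp: decseq_def L_def)
  define B where "B n = (\<lambda>x. x g) ` L n" for n
  have "subgroup (B n) A" for n
  proof (rule A.subgroupI)
    show "B n \<subseteq> carrier A" using L\<Sigma> gI by (auto simp: B_def)
    show "B n \<noteq> {}" using DL(5) by (auto simp: B_def)
    show "inv a \<in> B n" if "a \<in> B n" for a
      using that DL(4) L\<Sigma> gI inv_apply unfolding B_def by (smt (verit) image_iff)
    show "a \<otimes> b \<in> B n" if "a \<in> B n" "b \<in> B n" for a b
      using that DL(3) gI mult_apply unfolding B_def by (smt (verit) image_iff)
  qed
  moreover have "act r a \<in> B n" if "r \<in> Om" "a \<in> B n" for n r a
    using that DL(6) gI pact_apply unfolding B_def by (smt (verit) image_iff)
  moreover have "decseq B"
    using dec_L by (auto simp: decseq_def B_def)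
  ultimately obtain N' where N': "\<And>n. n \<ge> N' \<Longrightarrow> B n = B N'"
    using dcc[of B] by blast
  show ?case
  proof (rule exI[of _ "max N N'"], intro allI impI ballI)
    fix n x assume n: "max N N' \<le> n" and x: "x \<in> K (max N N')"
    have "x \<in> K N" using x decseqD[OF insert.prems(3), of N "max N N'"] by auto
    then obtain z where z: "z \<in> K n" "\<forall>i\<in>E. z i = x i" using N[of n x] n by auto
    \<comment> \<open>Since \<open>z\<close> and \<open>x\<close> agree on \<open>E\<close>, the
      quotient z^-1 x is trivial there. Its value at \<open>g\<close> is matched by some
      \<open>w\<close> in \<open>L n\<close>, so z w equals \<open>x\<close> at \<open>g\<close> and
      is unchanged on \<open>E\<close>.\<close>
    have z': "z \<in> K (max N N')" using z(1) decseqD[OF insert.prems(3) n] by auto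
    have "inv\<^bsub>W\<^esub> z \<otimes>\<^bsub>W\<^esub> x \<in> L (max N N')"
      unfolding L_def using D(3,4) x z' z(2) K\<Sigma> EI diff_eq_one_iff by auto
    then have "(inv\<^bsub>W\<^esub> z \<otimes>\<^bsub>W\<^esub> x) g \<in> B n"
      using N'[of n] N'[of "max N N'"] n by (auto simp: B_def)
    then obtain w where w: "w \<in> L n" "w g = (inv\<^bsub>W\<^esub> z \<otimes>\<^bsub>W\<^esub> x) g" unfolding B_def by fastforce
    have wK: "w \<in> K n" and w1: "\<And>i. i \<in> E \<Longrightarrow> w i = \<one>" using w(1) by (auto simp: L_def)
    have "(z \<otimes>\<^bsub>W\<^esub> w) i = x i" if "i \<in> insert g E" for i
    proof (cases "i = g")
      case True
      then show ?thesis using w(2) gI K\<Sigma> z(1) x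
        by (simp add: mult_apply inv_apply A.m_assoc[symmetric])
    next
      case False
      then have "i \<in> E" "z i = x i" "x i \<in> carrier A" using that z(2) EI K\<Sigma>[OF x] by auto
      then show ?thesis using w1 EI by (simp add: mult_apply)
    qed
    then show "\<exists>z\<in>K n. \<forall>i\<in>insert g E. z i = x i" using D(3) z(1) wK by blast
  qed
qed

text \<open>The hypotheses \<open>mult\<close> and \<open>diff\<close> make each nonempty
  \<open>C n\<close> a left coset of \<open>K n\<close>; translation by a base point reduces the
  claim to \<open>dcc_restriction\<close>.\<close>

lemma coset_restriction:
  assumes "finite F" "F \<subseteq> I" "\<And>n. admissible (K n)" "decseq K"
    and C: "\<And>n. C n \<noteq> {}" "\<And>n. C n \<subseteq> \<Sigma>" "decseq C"
    and mult: "\<And>n x k. x \<in> C n \<Longrightarrow> k \<in> K n \<Longrightarrow> x \<otimes>\<^bsub>W\<^esub> k \<in> C n"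
    and diff: "\<And>n x y. x \<in> C n \<Longrightarrow> y \<in> C n \<Longrightarrow> inv\<^bsub>W\<^esub> x \<otimes>\<^bsub>W\<^esub> y \<in> K n"
  shows "\<exists>N. \<forall>n\<ge>N. \<forall>x\<in>C N. \<exists>z\<in>C n. \<forall>i\<in>F. z i = x i"
proof -
  obtain N where N: "\<And>n k. n \<ge> N \<Longrightarrow> k \<in> K N \<Longrightarrow> \<exists>z\<in>K n. \<forall>i\<in>F. z i = k i"
    using dcc_restriction[OF assms(1-4)] by blast
  have "\<exists>z\<in>C n. \<forall>i\<in>F. z i = x i" if n: "n \<ge> N" and x: "x \<in> C N" for n x
  proof -
    \<comment> \<open>The base point comes from the smaller coset \<open>C n\<close>, so it also
      lies in \<open>C N\<close> and serves for both.\<close>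
    obtain c where c: "c \<in> C n" using C(1) by blast
    then have "c \<in> C N" using decseqD[OF C(3) \<open>n \<ge> N\<close>] by blast
    then obtain k where k: "k \<in> K n" "\<forall>i\<in>F. k i = (inv\<^bsub>W\<^esub> c \<otimes>\<^bsub>W\<^esub> x) i"
      using N[OF n diff[OF _ x]] by blast
    have \<Sigma>: "c \<in> \<Sigma>" "x \<in> \<Sigma>" using c x C(2) by blast+
    have "(c \<otimes>\<^bsub>W\<^esub> k) i = x i" if "i \<in> F" for i
    proof -
      have "i \<in> I" using that \<open>F \<subseteq> I\<close> by blast
      then show ?thesis using k(2) that \<Sigma> by (simp add: mult_apply inv_apply A.m_assoc[symmetric])
    qed
    then show ?thesis using mult[OF c k(1)] by blast
  qed
  then show ?thesis by blast
qed

text \<open>Linear compactness: the restrictions of the cosets to a finite window stabilise, so that a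
  common element can be built along an exhaustion of the index set.\<close>

lemma decseq_cosets_Inter_nonempty:
  assumes K: "\<And>n. admissible (K n)" "decseq K"
    and C: "\<And>n. C n \<noteq> {}" "\<And>n. C n \<subseteq> \<Sigma>" "decseq C"
    and mult: "\<And>n x k. x \<in> C n \<Longrightarrow> k \<in> K n \<Longrightarrow> x \<otimes>\<^bsub>W\<^esub> k \<in> C n"
    and diff: "\<And>n x y. x \<in> C n \<Longrightarrow> y \<in> C n \<Longrightarrow> inv\<^bsub>W\<^esub> x \<otimes>\<^bsub>W\<^esub> y \<in> K n"
    and closed: "\<And>n x. x \<in> \<Sigma> \<Longrightarrow> (\<And>F. finite F \<Longrightarrow> F \<subseteq> I \<Longrightarrow> \<exists>z\<in>C n. \<forall>i\<in>F. z i = x i) \<Longrightarrow> x \<in> C n"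
  shows "\<exists>x. \<forall>n. x \<in> C n"
proof -
  \<comment> \<open>Finite windows from an enumeration of \<open>I\<close>. Intersecting with
    \<open>I\<close> guards against the unspecified value of \<open>from_nat_into\<close> when
    \<open>I\<close> is empty.\<close>
  define E where "E m = I \<inter> from_nat_into I ` {..<m}" for m
  have E: "finite (E m)" "E m \<subseteq> I" for m by (simp_all add: E_def)
  have E_mono: "E m \<subseteq> E m'" if "m \<le> m'" for m m' using that by (auto simp: E_def)
  have E_ex: "\<exists>m. F \<subseteq> E m" if "finite F" "F \<subseteq> I" for F
  proof -
    define t where "t = to_nat_on I"
    have t: "from_nat_into I (t i) = i" if "i \<in> F" for i
      using that \<open>F \<subseteq> I\<close> countable_I by (auto simp: t_def)
    have "finite (t ` F)" using that(1) by simp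
    then obtain m where m: "\<forall>k\<in>t ` F. k < m" unfolding finite_nat_set_iff_bounded by blast
    have "F \<subseteq> E m"
    proof
      fix i assume i: "i \<in> F"
      then have "t i \<in> {..<m}" using m by blast
      then have "from_nat_into I (t i) \<in> from_nat_into I ` {..<m}" by (rule imageI)
      then show "i \<in> E m" using t[OF i] i \<open>F \<subseteq> I\<close> unfolding E_def by auto
    qed
    then show ?thesis by blast
  qed
  have "\<exists>N. \<forall>n\<ge>N. \<forall>x\<in>C N. \<exists>z\<in>C n. \<forall>i\<in>E m. z i = x i" for m
    by (rule coset_restriction[OF E K C mult diff])
  then obtain N where N: "\<And>m n x. n \<ge> N m \<Longrightarrow> x \<in> C (N m) \<Longrightarrow> \<exists>z\<in>C n. \<forall>i\<in>E m. z i = x i"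
    by metis
  \<comment> \<open>Each \<open>s m\<close> is taken at the level \<open>N m\<close> where
    restrictions to \<open>E m\<close> have stabilised; hence it can be replaced by an element of
    the next level without changing \<open>E m\<close>.\<close>
  have "\<exists>s. \<forall>m. s m \<in> C (N m) \<and> (\<forall>i\<in>E m. s (Suc m) i = s m i)"
  proof (rule dependent_nat_choice)
    show "\<exists>x. x \<in> C (N 0)" using C(1) by blast
    fix x m assume x: "x \<in> C (N m)"
    obtain z where z: "z \<in> C (max (N m) (N (Suc m)))" "\<forall>i\<in>E m. z i = x i"
      using N[OF max.cobounded1 x] by blast
    then show "\<exists>y. y \<in> C (N (Suc m)) \<and> (\<forall>i\<in>E m. y i = x i)"
      using decseqD[OF C(3) max.cobounded2] by blast
  qed
  then obtain s where s: "\<And>m. s m \<in> C (N m)" "\<And>m i. i \<in> E m \<Longrightarrow> s (Suc m) i = s m i" by blast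
  have s_stable: "s m' i = s m i" if "i \<in> E m" "m \<le> m'" for m m' i
    using that(2)
  proof (induction m' rule: dec_induct)
    case (step k)
    then show ?case using s(2)[of i k] E_mono[of m k] that(1) by auto
  qed simp
  \<comment> \<open>The limit is read off coordinatewise, at the first stage whose window contains
    the coordinate; later stages keep this value.\<close>
  define first where "first i = (LEAST m. i \<in> E m)" for i
  have first: "i \<in> E (first i)" if "i \<in> I" for i
    unfolding first_def by (rule LeastI_ex) (use E_ex[of "{i}"] that in simp)
  define x where "x = (\<lambda>i\<in>I. s (first i) i)"
  have x_eq: "x i = s m i" if "i \<in> E m" for i m
  proof -
    have i: "i \<in> I" using that E(2) by blast
    have "first i \<le> m" unfolding first_def by (rule Least_le) (rule that)
    then have "s m i = s (first i) i" by (rule s_stable[OF first[OF i]])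
    then show ?thesis using i by (simp add: x_def)
  qed
  have approx: "\<exists>z\<in>C n. \<forall>i\<in>F. z i = x i" if "finite F" "F \<subseteq> I" for n F
  proof -
    \<comment> \<open>On \<open>E m\<close> the limit equals \<open>s m\<close>, which stability at
      \<open>N m\<close> lets one match arbitrarily deep in the chain, in particular inside
      \<open>C n\<close>.\<close>
    obtain m where m: "F \<subseteq> E m" using E_ex \<open>finite F\<close> \<open>F \<subseteq> I\<close> by blast
    obtain z where z: "z \<in> C (max n (N m))" "\<forall>i\<in>E m. z i = s m i"
      using N[OF max.cobounded2 s(1)] by blast
    then have "z \<in> C n" using decseqD[OF C(3) max.cobounded1] by blast
    moreover have "z i = x i" if "i \<in> F" for i
    proof -
      have "i \<in> E m" using that m by blast
      then show ?thesis using z(2) x_eq by simp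
    qed
    ultimately show ?thesis by blast
  qed
  have "x \<in> \<Sigma>"
  proof (rule closed_\<Sigma>)
    show "x \<in> I \<rightarrow>\<^sub>E carrier A"
    proof (rule PiE_I)
      show "x i \<in> carrier A" if "i \<in> I" for i
      proof -
        have "s (first i) \<in> \<Sigma>" using s(1) C(2) by blast
        then show ?thesis using that by (simp add: x_def)
      qed
    qed (simp add: x_def)
    show "\<exists>z\<in>\<Sigma>. \<forall>i\<in>F. z i = x i" if "finite F" "F \<subseteq> I" for F
      using approx[OF that] C(2) by blast
  qed
  then have "x \<in> C n" for n by (rule closed) (rule approx)
  then show ?thesis by blast
qed

end

section \<open>Finite type of orbit families\<close>

text \<open>Different numbers may act by the same endomorphism, so relations among the generators of
  a finitely generated commutative monoid are allowed.\<close>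

locale smooth_power_action = operator_power A Om act I \<Sigma>
  for A :: "('a, 'm) monoid_scheme" (structure) and Om :: "'r set" and act :: "'r \<Rightarrow> 'a \<Rightarrow> 'a"
    and I :: "'g set" and \<Sigma> :: "('g \<Rightarrow> 'a) set" +
  fixes Q :: "nat set" and \<pi> :: "nat \<Rightarrow> ('g \<Rightarrow> 'a) \<Rightarrow> 'g \<Rightarrow> 'a"
  assumes finite_Q: "finite Q"
    and endo: "u \<in> smooth_numbers Q \<Longrightarrow> \<pi> u \<in> operator_endos"
    and comp: "u \<in> smooth_numbers Q \<Longrightarrow> v \<in> smooth_numbers Q \<Longrightarrow> x \<in> \<Sigma> \<Longrightarrow> \<pi> (u * v) x = \<pi> u (\<pi> v x)"
    and unif: "u \<in> smooth_numbers Q \<Longrightarrow> finite E \<Longrightarrow> E \<subseteq> I \<Longrightarrow> \<exists>F. finite F \<and> F \<subseteq> I \<and>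
      (\<forall>x\<in>\<Sigma>. \<forall>y\<in>\<Sigma>. (\<forall>i\<in>F. x i = y i) \<longrightarrow> (\<forall>i\<in>E. \<pi> u x i = \<pi> u y i))"
begin

abbreviation V where "V \<equiv> smooth_numbers Q"

text \<open>Elements whose orbit family on \<open>E\<close> starts at \<open>v\<close> or later.
  Their images under \<open>\<pi> v\<close> are the possible leading coefficients at
  \<open>v\<close>, as in Groebner basis theory.\<close>

definition initial_kernel where
  "initial_kernel E v = {x \<in> \<Sigma>. \<forall>u\<in>{u\<in>V. u < v}. \<forall>i\<in>E. \<pi> u x i = \<one>}"

lemma admissible_initial_kernel: "E \<subseteq> I \<Longrightarrow> admissible (initial_kernel E v)"
  unfolding initial_kernel_def by (rule admissible_fiber[OF admissible_\<Sigma>]) (auto simp: endo)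

text \<open>If w = v c, then \<open>\<pi> c\<close> carries the initial kernel at \<open>w\<close>
  into the one at \<open>v\<close>, because u < v gives u c < w; moreover \<open>\<pi> w\<close> is
  \<open>\<pi> v\<close> after \<open>\<pi> c\<close>.\<close>

lemma leading_image_dvd:
  assumes "w \<in> V" "v dvd w"
  shows "\<pi> w ` initial_kernel E w \<subseteq> \<pi> v ` initial_kernel E v"
proof
  obtain c where c: "w = v * c" using \<open>v dvd w\<close> by blast
  then have cV: "c \<in> V" "v \<in> V" using \<open>w \<in> V\<close> by (auto simp: smooth_numbers_mult)
  fix y assume "y \<in> \<pi> w ` initial_kernel E w"
  then obtain x where x: "y = \<pi> w x" "x \<in> initial_kernel E w" by blast
  then have "x \<in> \<Sigma>" by (simp add: initial_kernel_def)
  have "\<pi> u (\<pi> c x) i = \<one>" if "u \<in> V" "u < v" "i \<in> E" for u i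
  proof -
    \<comment> \<open>The strict inequality uses that the smooth number \<open>c\<close> is
      positive.\<close>
    have "u * c \<in> V" "u * c < w" using that cV c by (auto simp: smooth_numbers_mult) (simp add: smooth_numbers_def)
    then have "\<pi> (u * c) x i = \<one>" using x(2) that(3) by (simp add: initial_kernel_def)
    then show ?thesis using comp[OF \<open>u \<in> V\<close> cV(1) \<open>x \<in> \<Sigma>\<close>] by simp
  qed
  then have "\<pi> c x \<in> initial_kernel E v"
    using endo_simps(1)[OF endo[OF cV(1)] \<open>x \<in> \<Sigma>\<close>] by (auto simp: initial_kernel_def)
  then show "y \<in> \<pi> v ` initial_kernel E v"
    using x(1) c comp[OF cV(2,1) \<open>x \<in> \<Sigma>\<close>] by auto
qed

text \<open>Leading images are admissible, so \<open>dcc_restriction\<close> provides the chain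
  condition behind \<open>bounded_stable_divisors\<close>. They are compared on \<open>E\<close>
  only, where this condition is available.\<close>

lemma bounded_leading_images:
  assumes "finite E" "E \<subseteq> I"
  shows "\<exists>M. \<forall>v\<in>V. \<exists>w. w dvd v \<and> w \<le> M \<and>
    (\<forall>d\<in>\<pi> w ` initial_kernel E w. \<exists>t\<in>\<pi> v ` initial_kernel E v. \<forall>i\<in>E. t i = d i)"
proof (rule bounded_stable_divisors[OF finite_Q])
  fix K assume K: "\<And>n :: nat. K n \<in> (\<lambda>v. \<pi> v ` initial_kernel E v) ` V" "decseq K"
  have "admissible (K n)" for n
    using K(1)[of n] admissible_image[OF admissible_initial_kernel[OF \<open>E \<subseteq> I\<close>] endo] by auto
  then obtain N where "\<forall>n\<ge>N. \<forall>x\<in>K N. \<exists>z\<in>K n. \<forall>i\<in>E. z i = x i"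
    using dcc_restriction[OF assms _ K(2)] by blast
  then show "\<exists>n. \<forall>d\<in>K n. \<exists>t\<in>K (Suc n). \<forall>i\<in>E. t i = d i" by (metis le_SucI order_refl)
qed (use leading_image_dvd in auto)

text \<open>With \<open>n = w * c\<close>, a local solution \<open>z\<close> at \<open>c\<close> and a partial solution \<open>x\<close> below \<open>n\<close>, the
  difference \<open>z\<^sup>-\<^sup>1 \<pi> c x\<close> lies in \<open>initial_kernel E w\<close>, so its image under \<open>\<pi> w\<close> is that of some \<open>t\<close> in \<open>initial_kernel E n\<close>
  under \<open>\<pi> n\<close>; the corrected solution is \<open>x t\<^sup>-\<^sup>1\<close>.\<close>

lemma finite_type_step:
  assumes E: "E \<subseteq> I"
    and M: "\<forall>v\<in>V. \<exists>w. w dvd v \<and> w \<le> M \<and>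
      (\<forall>d\<in>\<pi> w ` initial_kernel E w. \<exists>t\<in>\<pi> v ` initial_kernel E v. \<forall>i\<in>E. t i = d i)"
    and y: "\<And>c. c \<in> V \<Longrightarrow> \<exists>z\<in>\<Sigma>. \<forall>u\<in>V. u \<le> M \<longrightarrow> (\<forall>i\<in>E. \<pi> u z i = y (u * c) i)"
  shows "\<exists>x\<in>\<Sigma>. \<forall>u\<in>V. u < n \<longrightarrow> (\<forall>i\<in>E. \<pi> u x i = y u i)"
proof (induction n)
  case 0
  then show ?case using W.one_closed by auto
next
  case (Suc n)
  then obtain x where x: "x \<in> \<Sigma>" "\<And>u i. u \<in> V \<Longrightarrow> u < n \<Longrightarrow> i \<in> E \<Longrightarrow> \<pi> u x i = y u i" by blast
  show ?case
  proof (cases "n \<in> V")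
    case False
    then have "u < n" if "u \<in> V" "u < Suc n" for u
      using that by (cases "u = n") auto
    then show ?thesis using x by blast
  next
    case True
    obtain w where w: "w dvd n" "w \<le> M"
      "\<forall>d\<in>\<pi> w ` initial_kernel E w. \<exists>t\<in>\<pi> n ` initial_kernel E n. \<forall>i\<in>E. t i = d i"
      using M True by blast
    then obtain c where c: "n = w * c" by blast
    then have V: "c \<in> V" "w \<in> V" using True by (auto simp: smooth_numbers_mult)
    obtain z where z: "z \<in> \<Sigma>" "\<And>u i. u \<in> V \<Longrightarrow> u \<le> M \<Longrightarrow> i \<in> E \<Longrightarrow> \<pi> u z i = y (u * c) i"
      using y[OF V(1)] by blast
    define d where "d = inv\<^bsub>W\<^esub> z \<otimes>\<^bsub>W\<^esub> \<pi> c x"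
    have cx: "\<pi> c x \<in> \<Sigma>" using endo_simps(1)[OF endo[OF V(1)] x(1)] .
    have "inv\<^bsub>W\<^esub> z \<in> \<Sigma>" using W.inv_closed[of z] z(1) by simp
    then have d\<Sigma>: "d \<in> \<Sigma>" using W.m_closed[of "inv\<^bsub>W\<^esub> z" "\<pi> c x"] cx by (simp add: d_def)
    have d_eq: "\<pi> u d = inv\<^bsub>W\<^esub> (\<pi> u z) \<otimes>\<^bsub>W\<^esub> \<pi> (u * c) x" if "u \<in> V" for u
      using endo_simps[OF endo[OF that]] z(1) cx W.inv_closed comp[OF that V(1) x(1)]
      by (simp add: d_def)
    \<comment> \<open>For u < w, both u < M and u c < n hold: \<open>z\<close> and \<open>x\<close>
      already have the prescribed value y(u c), so their quotient is trivial.\<close>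
    have "\<pi> u d i = \<one>" if "u \<in> V" "u < w" "i \<in> E" for u i
    proof -
      have uc: "u * c \<in> V" "u * c < n"
        using that V c by (auto simp: smooth_numbers_mult) (simp add: smooth_numbers_def)
      have "\<pi> u z i = \<pi> (u * c) x i" using z(2) x(2) uc that w(2) by simp
      then show ?thesis
        using diff_eq_one_iff endo_simps(1)[OF endo] z(1) x(1) uc(1) that E d_eq by auto
    qed
    then have "d \<in> initial_kernel E w" using d\<Sigma> by (simp add: initial_kernel_def)
    then obtain t where t: "t \<in> initial_kernel E n" "\<And>i. i \<in> E \<Longrightarrow> \<pi> n t i = \<pi> w d i"
      using w(3) by auto
    have t\<Sigma>: "t \<in> \<Sigma>" using t(1) by (simp add: initial_kernel_def)
    have x'\<Sigma>: "x \<otimes>\<^bsub>W\<^esub> inv\<^bsub>W\<^esub> t \<in> \<Sigma>" using x(1) t\<Sigma> W.m_closed W.inv_closed by simp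
    have "\<pi> u (x \<otimes>\<^bsub>W\<^esub> inv\<^bsub>W\<^esub> t) i = y u i" if u: "u \<in> V" "u < Suc n" "i \<in> E" for u i
    proof -
      have iI: "i \<in> I" using u(3) E by blast
      note s = endo_simps[OF endo[OF u(1)]]
      have eq: "\<pi> u (x \<otimes>\<^bsub>W\<^esub> inv\<^bsub>W\<^esub> t) i = \<pi> u x i \<otimes> inv (\<pi> u t i)"
        using s x(1) t\<Sigma> W.inv_closed iI by (simp add: mult_apply inv_apply)
      have car: "\<pi> u x i \<in> carrier A" "\<pi> u z i \<in> carrier A" using s(1) x(1) z(1) iI by auto
      show ?thesis
      proof (cases "u = n")
        case False
        then have "u < n" using u(2) by simp
        then have "\<pi> u t i = \<one>" using t(1) u by (simp add: initial_kernel_def)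
        then show ?thesis using eq x(2)[OF u(1) \<open>u < n\<close> u(3)] car by simp
      next
        case True
        \<comment> \<open>At \<open>n\<close> the correction is (\<open>\<pi> w z\<close>)^-1
          \<open>\<pi> n x\<close>. Dividing \<open>\<pi> n x\<close> by it on the right leaves
          \<open>\<pi> w z\<close>, which has the prescribed value y(w c) = y(n); the order of the
          factors matters.\<close>
        have wz: "\<pi> w z i \<in> carrier A"
          using endo_simps(1)[OF endo[OF V(2)] z(1)] iI by simp
        have zy: "\<pi> w z i = y u i" using z(2)[OF V(2) w(2) u(3)] True c by simp
        have "\<pi> n t i = (inv\<^bsub>W\<^esub> (\<pi> w z) \<otimes>\<^bsub>W\<^esub> \<pi> n x) i"
          using t(2)[OF u(3)] d_eq[OF V(2)] c by simp
        then have t_eq: "\<pi> u t i = inv (\<pi> w z i) \<otimes> \<pi> u x i"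
          using endo_simps(1)[OF endo[OF V(2)] z(1)] iI True by (simp add: mult_apply inv_apply)
        have "\<pi> u x i \<otimes> inv (inv (\<pi> w z i) \<otimes> \<pi> u x i) = \<pi> u x i \<otimes> (inv (\<pi> u x i) \<otimes> \<pi> w z i)"
          using wz car(1) by (simp add: A.inv_mult_group)
        also have "\<dots> = \<pi> w z i"
          using wz car(1) A.m_assoc[of "\<pi> u x i" "inv (\<pi> u x i)" "\<pi> w z i"] by simp
        finally show ?thesis by (simp only: eq t_eq zy)
      qed
    qed
    then show ?thesis using x'\<Sigma> by blast
  qed
qed

text \<open>The bound \<open>M\<close> depends on the window alone, which later makes \<delta>
  uniform over pseudo-orbits. Solutions on all initial segments are combined by linear
  compactness.\<close>

theorem finite_type:
  assumes E: "finite E" "E \<subseteq> I"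
  shows "\<exists>M. \<forall>y. (\<forall>c\<in>V. \<exists>z\<in>\<Sigma>. \<forall>u\<in>V. u \<le> M \<longrightarrow> (\<forall>i\<in>E. \<pi> u z i = y (u * c) i)) \<longrightarrow>
    (\<exists>x\<in>\<Sigma>. \<forall>u\<in>V. \<forall>i\<in>E. \<pi> u x i = y u i)"
proof -
  obtain M where M: "\<forall>v\<in>V. \<exists>w. w dvd v \<and> w \<le> M \<and>
      (\<forall>d\<in>\<pi> w ` initial_kernel E w. \<exists>t\<in>\<pi> v ` initial_kernel E v. \<forall>i\<in>E. t i = d i)"
    using bounded_leading_images[OF E] by blast
  have "\<exists>x\<in>\<Sigma>. \<forall>u\<in>V. \<forall>i\<in>E. \<pi> u x i = y u i"
    if y: "\<forall>c\<in>V. \<exists>z\<in>\<Sigma>. \<forall>u\<in>V. u \<le> M \<longrightarrow> (\<forall>i\<in>E. \<pi> u z i = y (u * c) i)" for y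
  proof -
    \<comment> \<open>The solution set on an initial segment is a coset of the initial kernel at
      \<open>n\<close>.\<close>
    define C where "C n = {x \<in> \<Sigma>. \<forall>u\<in>V. u < n \<longrightarrow> (\<forall>i\<in>E. \<pi> u x i = y u i)}" for n
    have iI: "\<And>i. i \<in> E \<Longrightarrow> i \<in> I" using E(2) by blast
    note s = endo_simps[OF endo]
    have "\<exists>x. \<forall>n. x \<in> C n"
    proof (rule decseq_cosets_Inter_nonempty)
      show "admissible (initial_kernel E n)" for n using admissible_initial_kernel[OF E(2)] .
      show "decseq (initial_kernel E)" by (auto simp: decseq_def initial_kernel_def)
      show "C n \<noteq> {}" for n
        using finite_type_step[OF E(2) M, of y n] y by (auto simp: C_def)
      show "C n \<subseteq> \<Sigma>" for n by (auto simp: C_def)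
      show "decseq C" by (auto simp: decseq_def C_def)
      show "x \<otimes>\<^bsub>W\<^esub> k \<in> C n" if "x \<in> C n" "k \<in> initial_kernel E n" for x k n
      proof -
        have \<Sigma>: "x \<in> \<Sigma>" "k \<in> \<Sigma>" using that by (auto simp: C_def initial_kernel_def)
        have "\<pi> u (x \<otimes>\<^bsub>W\<^esub> k) i = y u i" if u: "u \<in> V" "u < n" "i \<in> E" for u i
        proof -
          have "\<pi> u x i = y u i" "\<pi> u k i = \<one>"
            using \<open>x \<in> C n\<close> \<open>k \<in> initial_kernel E n\<close> u by (auto simp: C_def initial_kernel_def)
          moreover have "\<pi> u x i \<in> carrier A" using s(1)[OF u(1) \<Sigma>(1)] iI[OF u(3)] by simp
          ultimately show ?thesis
            using s(2)[OF u(1) \<Sigma>] iI[OF u(3)] by (simp add: mult_apply)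
        qed
        then show ?thesis using \<Sigma> W.m_closed by (auto simp: C_def)
      qed
      show "inv\<^bsub>W\<^esub> x \<otimes>\<^bsub>W\<^esub> x' \<in> initial_kernel E n" if "x \<in> C n" "x' \<in> C n" for x x' n
      proof -
        have \<Sigma>: "x \<in> \<Sigma>" "x' \<in> \<Sigma>" using that by (auto simp: C_def)
        then have "\<pi> u (inv\<^bsub>W\<^esub> x \<otimes>\<^bsub>W\<^esub> x') i = \<one>" if u: "u \<in> V" "u < n" "i \<in> E" for u i
        proof -
          have "\<pi> u x i = y u i" "\<pi> u x' i = y u i"
            using \<open>x \<in> C n\<close> \<open>x' \<in> C n\<close> u by (auto simp: C_def)
          moreover have "\<pi> u (inv\<^bsub>W\<^esub> x \<otimes>\<^bsub>W\<^esub> x') = inv\<^bsub>W\<^esub> (\<pi> u x) \<otimes>\<^bsub>W\<^esub> \<pi> u x'"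
            using s(2,3)[OF u(1)] W.inv_closed[of x] \<Sigma> by simp
          ultimately show ?thesis
            using diff_eq_one_iff[of "\<pi> u x" "\<pi> u x'" i] s(1)[OF u(1)] \<Sigma> iI[OF u(3)] by simp
        qed
        then show ?thesis using \<Sigma> W.m_closed W.inv_closed by (auto simp: initial_kernel_def)
      qed
      fix n x assume x: "x \<in> \<Sigma>"
        and cl: "\<And>F. finite F \<Longrightarrow> F \<subseteq> I \<Longrightarrow> \<exists>z\<in>C n. \<forall>i\<in>F. z i = x i"
      have "\<pi> u x i = y u i" if u: "u \<in> V" "u < n" "i \<in> E" for u i
      proof -
        \<comment> \<open>Uniform continuity of \<open>\<pi> u\<close> makes the solution set
          closed: an approximant agreeing on \<open>F\<close> has the same image on
          \<open>E\<close>.\<close>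
        obtain F where F: "finite F" "F \<subseteq> I"
          "\<forall>x\<in>\<Sigma>. \<forall>y\<in>\<Sigma>. (\<forall>i\<in>F. x i = y i) \<longrightarrow> (\<forall>i\<in>E. \<pi> u x i = \<pi> u y i)"
          using unif[OF u(1) E] by blast
        obtain z where z: "z \<in> C n" "\<forall>i\<in>F. z i = x i" using cl[OF F(1,2)] by blast
        then have z': "z \<in> \<Sigma>" "\<pi> u z i = y u i" using u by (auto simp: C_def)
        then have "\<pi> u z i = \<pi> u x i" using F(3) x z(2) u(3) by blast
        then show ?thesis using z'(2) by simp
      qed
      then show "x \<in> C n" using x by (auto simp: C_def)
    qed
    then obtain x where x: "\<And>n. x \<in> C n" by blast
    then have "\<pi> u x i = y u i" if "u \<in> V" "i \<in> E" for u i
      using x[of "Suc u"] that by (auto simp: C_def)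
    moreover have "x \<in> \<Sigma>" using x[of 0] by (simp add: C_def)
    ultimately show ?thesis by blast
  qed
  then show ?thesis by blast
qed

end

section \<open>Shadowing\<close>

text \<open>Assign distinct primes to the generators and extend multiplicatively through prime
  exponents; commutativity makes this a homomorphism, and generation makes it surjective.\<close>

lemma (in comm_monoid) smooth_number_coding:
  assumes S: "finite_generating_set G S"
  obtains Q \<pi> where "finite Q" "\<And>u. u \<in> smooth_numbers Q \<Longrightarrow> \<pi> u \<in> carrier G"
    "\<And>u v. u \<in> smooth_numbers Q \<Longrightarrow> v \<in> smooth_numbers Q \<Longrightarrow> \<pi> (u * v) = \<pi> u \<otimes> \<pi> v"
    "\<And>\<sigma>. \<sigma> \<in> carrier G \<Longrightarrow> \<exists>u\<in>smooth_numbers Q. \<pi> u = \<sigma>"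
proof -
  have fin: "finite S" and SG: "S \<subseteq> carrier G" and gen: "monoid_generate G S = carrier G"
    using S by (auto simp: finite_generating_set_def)
  obtain Q where Q: "Q \<subseteq> {p :: nat. Factorial_Ring.prime p}" "finite Q" "card Q = card S"
    using infinite_arbitrarily_large[OF primes_infinite] by blast
  obtain s where s: "bij_betw s Q S"
    using finite_same_card_bij[OF Q(2) fin Q(3)] by blast
  then have s_car: "s p \<in> carrier G" if "p \<in> Q" for p
    using that SG by (auto simp: bij_betw_def)
  define \<pi> where "\<pi> n = finprod G (\<lambda>p. s p [^] (multiplicity p n)) Q" for n :: nat
  have pow_car: "(\<lambda>p. s p [^] (multiplicity p n)) \<in> Q \<rightarrow> carrier G" for n :: nat
    using s_car by auto
  have \<pi>_mult: "\<pi> (u * v) = \<pi> u \<otimes> \<pi> v" if "u \<in> smooth_numbers Q" "v \<in> smooth_numbers Q" for u v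
  proof -
    have "\<pi> (u * v) = finprod G (\<lambda>p. s p [^] (multiplicity p u) \<otimes> s p [^] (multiplicity p v)) Q"
      unfolding \<pi>_def
    proof (rule finprod_cong')
      fix p assume p: "p \<in> Q"
      then have "multiplicity p (u * v) = multiplicity p u + multiplicity p v"
        using Q(1) that by (intro prime_elem_multiplicity_mult_distrib) (auto simp: smooth_numbers_def)
      then show "s p [^] (multiplicity p (u * v)) = s p [^] (multiplicity p u) \<otimes> s p [^] (multiplicity p v)"
        using s_car[OF p] by (simp add: nat_pow_mult)
    qed (use s_car in auto)
    also have "\<dots> = \<pi> u \<otimes> \<pi> v" unfolding \<pi>_def by (rule finprod_multf[OF pow_car pow_car])
    finally show ?thesis .
  qed
  have \<pi>_prime: "\<pi> q = s q" if q: "q \<in> Q" for q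
  proof -
    \<comment> \<open>The exponent of \<open>p\<close> in \<open>q\<close> is one for p = q and zero
      otherwise, so one factor remains.\<close>
    have "\<pi> q = finprod G (\<lambda>p. if q = p then s p else \<one>) Q"
      unfolding \<pi>_def
    proof (rule finprod_cong')
      fix p assume p: "p \<in> Q"
      have "Factorial_Ring.prime p" "Factorial_Ring.prime q" using p q Q(1) by auto
      then show "s p [^] (multiplicity p q) = (if q = p then s p else \<one>)"
        using s_car[OF p] by (auto simp: prime_multiplicity_other)
    qed (use s_car in auto)
    also have "\<dots> = s q" using finprod_singleton[OF q Q(2), of s] s_car by auto
    finally show ?thesis .
  qed
  have "\<exists>u\<in>smooth_numbers Q. \<pi> u = \<sigma>" if "\<sigma> \<in> monoid_generate G S" for \<sigma>
    using that
  proof induction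
    case one
    have "\<pi> 1 = \<one>" unfolding \<pi>_def by (rule finprod_one_eqI) simp
    then show ?case using smooth_numbers_one by blast
  next
    case (incl \<sigma>)
    then obtain q where q: "q \<in> Q" "s q = \<sigma>" using s by (auto simp: bij_betw_def)
    then have "Factorial_Ring.prime q" using Q(1) by auto
    then have "q \<in> smooth_numbers Q"
      using q(1) by (auto simp: smooth_numbers_def prime_factorization_prime prime_gt_0_nat)
    then show ?case using \<pi>_prime q by blast
  next
    case (mult \<sigma> \<tau>)
    then obtain u v where "u \<in> smooth_numbers Q" "\<pi> u = \<sigma>" "v \<in> smooth_numbers Q" "\<pi> v = \<tau>"
      by blast
    then show ?case using \<pi>_mult smooth_numbers_mult by metis
  qed
  moreover have "\<pi> u \<in> carrier G" for u unfolding \<pi>_def by (rule finprod_closed[OF pow_car])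
  ultimately show thesis using that[OF Q(2) _ \<pi>_mult] gen by blast
qed

section \<open>Hamming metrics and finite windows\<close>

lemma hamming_metric_le:
  assumes "\<forall>g\<in>E n. x g = y g"
  shows "hamming_metric E x y \<le> 1 / 2 ^ n"
proof (cases "SUP k \<in> {k. \<forall>g\<in>E k. x g = y g}. enat k")
  case (enat m)
  have "enat n \<le> (SUP k \<in> {k. \<forall>g\<in>E k. x g = y g}. enat k)"
    using assms by (intro SUP_upper) auto
  then have "n \<le> m" using enat by simp
  then show ?thesis using enat by (simp add: hamming_metric_def frac_le)
qed (simp add: hamming_metric_def)

lemma agree_if_hamming_metric_less:
  assumes less: "hamming_metric E x y < 1 / 2 ^ n" and E: "exhaustion G E" and g: "g \<in> E n"
  shows "x g = y g"
proof -
  define s where "s = (SUP k \<in> {k. \<forall>g\<in>E k. x g = y g}. enat k)"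
  have "enat n < s"
  proof (cases s)
    case (enat m)
    then have "1 / 2 ^ m < (1 / 2 ^ n :: real)" using less by (simp add: hamming_metric_def s_def)
    then have "n < m" by (simp add: field_simps)
    then show ?thesis using enat by simp
  qed simp
  \<comment> \<open>The supremum may be infinite, so an index above \<open>n\<close> is extracted;
    agreement on its window passes down to \<open>E n\<close> by nesting.\<close>
  then obtain k where k: "\<forall>g\<in>E k. x g = y g" "n < k"
    unfolding s_def by (auto simp: less_SUP_iff)
  have "E n \<subseteq> E k"
    using E k(2) lift_Suc_mono_le[of E n k] by (simp add: exhaustion_def)
  then show ?thesis using k(1) g by blast
qed

lemma exhaustion_finite_subset:
  assumes E: "exhaustion G E" and "finite F" "F \<subseteq> carrier G"
  shows "\<exists>n. F \<subseteq> E n"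
  using assms(2,3)
proof (induction F rule: finite_induct)
  case (insert g F)
  then obtain n where n: "F \<subseteq> E n" by blast
  have "(\<Union>n. E n) = carrier G" using E unfolding exhaustion_def by blast
  then obtain m where m: "g \<in> E m" using insert.prems by blast
  have "E n \<subseteq> E (max n m)" "E m \<subseteq> E (max n m)"
    using E lift_Suc_mono_le[of E] by (simp_all add: exhaustion_def)
  then show ?case using n m by blast
qed simp

text \<open>The exact form of the pseudo-orbit condition: over a discrete alphabet, small Hamming
  distance means equality on a finite window.\<close>

definition tracks where
  "tracks D F \<sigma> p \<longleftrightarrow> (\<forall>\<tau>\<in>carrier D. \<forall>i\<in>F. \<sigma> (p \<tau>) i = p (\<sigma> \<otimes>\<^bsub>D\<^esub> \<tau>) i)"

lemma tracks_mono: "tracks D F \<sigma> p \<Longrightarrow> F' \<subseteq> F \<Longrightarrow> tracks D F' \<sigma> p"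
  unfolding tracks_def by (meson subsetD)

lemma tracksI:
  assumes "\<And>\<tau> i. \<tau> \<in> carrier D \<Longrightarrow> i \<in> F \<Longrightarrow> \<sigma> (p \<tau>) i = p (\<sigma> \<otimes>\<^bsub>D\<^esub> \<tau>) i"
  shows "tracks D F \<sigma> p"
  unfolding tracks_def by (intro ballI assms)

lemma tracksD: "tracks D F \<sigma> p \<Longrightarrow> \<tau> \<in> carrier D \<Longrightarrow> i \<in> F \<Longrightarrow> \<sigma> (p \<tau>) i = p (\<sigma> \<otimes>\<^bsub>D\<^esub> \<tau>) i"
  unfolding tracks_def by (drule (1) bspec, drule (1) bspec)

lemma prodiscrete_uniformly_continuousD:
  assumes "prodiscrete_uniformly_continuous G \<Sigma> \<tau>" "finite E" "E \<subseteq> carrier G"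
  shows "\<exists>F. finite F \<and> F \<subseteq> carrier G \<and>
    (\<forall>x\<in>\<Sigma>. \<forall>y\<in>\<Sigma>. (\<forall>g\<in>F. x g = y g) \<longrightarrow> (\<forall>g\<in>E. \<tau> x g = \<tau> y g))"
  by (rule mp[OF spec[OF assms(1)[unfolded prodiscrete_uniformly_continuous_def]] conjI[OF assms(2,3)]])

section \<open>Propagation along pseudo-orbits and shadowing for operator powers\<close>

context operator_power
begin

text \<open>Exactness for generators on a large window forces exactness for a given \<sigma> on
  \<open>E\<close>, uniformly in \<open>p\<close>. The induction follows how \<sigma> is
  generated.\<close>

lemma pseudo_orbit_propagation:
  assumes G: "carrier G = I"
    and endos: "carrier D \<subseteq> operator_endos" and "monoid D"
    and D_mult: "\<And>\<sigma> \<tau> x. \<sigma> \<in> carrier D \<Longrightarrow> \<tau> \<in> carrier D \<Longrightarrow> x \<in> \<Sigma> \<Longrightarrow> (\<sigma> \<otimes>\<^bsub>D\<^esub> \<tau>) x = \<sigma> (\<tau> x)"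
    and D_one: "\<And>x. x \<in> \<Sigma> \<Longrightarrow> \<one>\<^bsub>D\<^esub> x = x"
    and unif: "\<And>\<tau>. \<tau> \<in> carrier D \<Longrightarrow> prodiscrete_uniformly_continuous G \<Sigma> \<tau>"
    and S: "finite_generating_set D S"
    and "\<sigma> \<in> carrier D" "finite E" "E \<subseteq> I"
  shows "\<exists>F. finite F \<and> F \<subseteq> I \<and>
    (\<forall>p\<in>carrier D \<rightarrow> \<Sigma>. (\<forall>s\<in>S. tracks D F s p) \<longrightarrow> tracks D E \<sigma> p)"
proof -
  interpret D: monoid D by fact
  have gen: "monoid_generate D S = carrier D"
    using S by (simp add: finite_generating_set_def)
  have "\<sigma> \<in> monoid_generate D S" using \<open>\<sigma> \<in> carrier D\<close> unfolding gen .
  then show ?thesis using \<open>finite E\<close> \<open>E \<subseteq> I\<close>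
  proof (induction arbitrary: E)
    case one
    have "tracks D E \<one>\<^bsub>D\<^esub> p" if "p \<in> carrier D \<rightarrow> \<Sigma>" for p
    proof (rule tracksI)
      fix \<tau> i assume \<tau>: "\<tau> \<in> carrier D"
      then have "p \<tau> \<in> \<Sigma>" using that by blast
      then show "\<one>\<^bsub>D\<^esub> (p \<tau>) i = p (\<one>\<^bsub>D\<^esub> \<otimes>\<^bsub>D\<^esub> \<tau>) i"
        using D_one[of "p \<tau>"] \<tau> by simp
    qed
    then show ?case using one.prems by blast
  next
    case (incl \<sigma>)
    then show ?case by blast
  next
    case (mult \<sigma> \<sigma>')
    have car: "\<sigma> \<in> carrier D" "\<sigma>' \<in> carrier D" using mult.hyps unfolding gen .
    \<comment> \<open>The window \<open>E'\<close> controls the outer factor \<sigma> on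
      \<open>E\<close>. The inner factor must therefore be exact on \<open>E'\<close>, while the
      outer one must be exact on \<open>E\<close>.\<close>
    obtain E' where E': "finite E'" "E' \<subseteq> I"
      "\<forall>x\<in>\<Sigma>. \<forall>y\<in>\<Sigma>. (\<forall>i\<in>E'. x i = y i) \<longrightarrow> (\<forall>i\<in>E. \<sigma> x i = \<sigma> y i)"
      using prodiscrete_uniformly_continuousD[OF unif[OF car(1)] mult.prems[folded G]] unfolding G
      by (elim exE conjE)
    obtain F where F: "finite F" "F \<subseteq> I"
      "\<forall>p\<in>carrier D \<rightarrow> \<Sigma>. (\<forall>s\<in>S. tracks D F s p) \<longrightarrow> tracks D E \<sigma> p"
      using mult.IH(1)[OF mult.prems] by blast
    obtain F' where F': "finite F'" "F' \<subseteq> I"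
      "\<forall>p\<in>carrier D \<rightarrow> \<Sigma>. (\<forall>s\<in>S. tracks D F' s p) \<longrightarrow> tracks D E' \<sigma>' p"
      using mult.IH(2)[OF E'(1,2)] by blast
    have "tracks D E (\<sigma> \<otimes>\<^bsub>D\<^esub> \<sigma>') p"
      if p: "p \<in> carrier D \<rightarrow> \<Sigma>" and S: "\<forall>s\<in>S. tracks D (F \<union> F') s p" for p
    proof (rule tracksI)
      fix \<tau> i assume \<tau>: "\<tau> \<in> carrier D" and i: "i \<in> E"
      have "\<forall>s\<in>S. tracks D F s p" "\<forall>s\<in>S. tracks D F' s p"
        using S tracks_mono[of D "F \<union> F'"] by blast+
      then have tr: "tracks D E \<sigma> p" "tracks D E' \<sigma>' p" using F(3) F'(3) p by blast+
      have \<tau>': "\<sigma>' \<otimes>\<^bsub>D\<^esub> \<tau> \<in> carrier D" using car(2) \<tau> by (rule D.m_closed)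
      have pt: "p \<tau> \<in> \<Sigma>" "p (\<sigma>' \<otimes>\<^bsub>D\<^esub> \<tau>) \<in> \<Sigma>" using p \<tau> \<tau>' by blast+
      have \<sigma>'p: "\<sigma>' (p \<tau>) \<in> \<Sigma>" by (rule endo_simps(1)[OF subsetD[OF endos car(2)] pt(1)])
      have "\<forall>i\<in>E'. \<sigma>' (p \<tau>) i = p (\<sigma>' \<otimes>\<^bsub>D\<^esub> \<tau>) i"
        by (rule ballI) (rule tracksD[OF tr(2) \<tau>])
      then have "\<sigma> (\<sigma>' (p \<tau>)) i = \<sigma> (p (\<sigma>' \<otimes>\<^bsub>D\<^esub> \<tau>)) i"
        using bspec[OF bspec[OF E'(3) \<sigma>'p] pt(2)] i by blast
      also have "\<dots> = p (\<sigma> \<otimes>\<^bsub>D\<^esub> (\<sigma>' \<otimes>\<^bsub>D\<^esub> \<tau>)) i"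
        by (rule tracksD[OF tr(1) \<tau>' i])
      finally show "(\<sigma> \<otimes>\<^bsub>D\<^esub> \<sigma>') (p \<tau>) i = p (\<sigma> \<otimes>\<^bsub>D\<^esub> \<sigma>' \<otimes>\<^bsub>D\<^esub> \<tau>) i"
        unfolding D_mult[OF car pt(1)] D.m_assoc[OF car \<tau>] .
    qed
    then show ?case using F(1,2) F'(1,2) by (intro exI[of _ "F \<union> F'"]) simp
  qed
qed

theorem shadowing:
  assumes G: "carrier G = I"
    and endos: "carrier D \<subseteq> operator_endos" and "comm_monoid D"
    and D_mult: "\<And>\<sigma> \<tau> x. \<sigma> \<in> carrier D \<Longrightarrow> \<tau> \<in> carrier D \<Longrightarrow> x \<in> \<Sigma> \<Longrightarrow> (\<sigma> \<otimes>\<^bsub>D\<^esub> \<tau>) x = \<sigma> (\<tau> x)"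
    and D_one: "\<And>x. x \<in> \<Sigma> \<Longrightarrow> \<one>\<^bsub>D\<^esub> x = x"
    and D_unif: "\<And>\<tau>. \<tau> \<in> carrier D \<Longrightarrow> prodiscrete_uniformly_continuous G \<Sigma> \<tau>"
  shows "shadowing_property G D \<Sigma> valuation_action"
  unfolding shadowing_property_def metric_shadowing_property_def
proof (intro allI impI, elim conjE)
  fix S Ex and \<epsilon> :: real
  assume S: "finite_generating_set D S" and Ex: "exhaustion G Ex" and "\<epsilon> > 0"
  interpret D: comm_monoid D by fact
  obtain Q \<pi> where \<pi>: "finite Q" "\<And>u. u \<in> smooth_numbers Q \<Longrightarrow> \<pi> u \<in> carrier D"
    "\<And>u v. u \<in> smooth_numbers Q \<Longrightarrow> v \<in> smooth_numbers Q \<Longrightarrow> \<pi> (u * v) = \<pi> u \<otimes>\<^bsub>D\<^esub> \<pi> v"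
    "\<And>\<sigma>. \<sigma> \<in> carrier D \<Longrightarrow> \<exists>u\<in>smooth_numbers Q. \<pi> u = \<sigma>"
    using D.smooth_number_coding[OF S] by blast
  interpret smooth_power_action A Om act I \<Sigma> Q \<pi>
  proof unfold_locales
    show "finite Q" by fact
    show "\<pi> u \<in> operator_endos" if "u \<in> smooth_numbers Q" for u using endos \<pi>(2)[OF that] by blast
    show "\<pi> (u * v) x = \<pi> u (\<pi> v x)"
      if "u \<in> smooth_numbers Q" "v \<in> smooth_numbers Q" "x \<in> \<Sigma>" for u v x
      using that \<pi>(2,3) D_mult by simp
    show "\<exists>F. finite F \<and> F \<subseteq> I \<and>
      (\<forall>x\<in>\<Sigma>. \<forall>y\<in>\<Sigma>. (\<forall>i\<in>F. x i = y i) \<longrightarrow> (\<forall>i\<in>E. \<pi> u x i = \<pi> u y i))"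
      if "u \<in> smooth_numbers Q" "finite E" "E \<subseteq> I" for u E
      by (rule prodiscrete_uniformly_continuousD[OF D_unif[OF \<pi>(2)[OF that(1)]] that(2,3)[folded G],
        unfolded G])
  qed
  \<comment> \<open>Agreement on \<open>Ex n\<close> suffices for distance below \<epsilon>.\<close>
  obtain n where n: "(1 / 2) ^ n < \<epsilon>"
    using real_arch_pow_inv[OF \<open>\<epsilon> > 0\<close>, of "1 / 2"] by auto
  have E: "finite (Ex n)" "Ex n \<subseteq> I" using Ex G by (auto simp: exhaustion_def)
  obtain M where M: "\<And>y. \<forall>c\<in>V. \<exists>z\<in>\<Sigma>. \<forall>u\<in>V. u \<le> M \<longrightarrow> (\<forall>i\<in>Ex n. \<pi> u z i = y (u * c) i) \<Longrightarrow>
    \<exists>x\<in>\<Sigma>. \<forall>u\<in>V. \<forall>i\<in>Ex n. \<pi> u x i = y u i"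
    using finite_type[OF E] by blast
  have "\<exists>F. finite F \<and> F \<subseteq> I \<and>
    (\<forall>p\<in>carrier D \<rightarrow> \<Sigma>. (\<forall>s\<in>S. tracks D F s p) \<longrightarrow> tracks D (Ex n) (\<pi> u) p)" if "u \<in> V" for u
    by (rule pseudo_orbit_propagation[OF G endos D.monoid_axioms D_mult D_one D_unif S \<pi>(2)[OF that] E])
  then obtain F where F: "\<And>u. u \<in> V \<Longrightarrow> finite (F u) \<and> F u \<subseteq> I \<and>
    (\<forall>p\<in>carrier D \<rightarrow> \<Sigma>. (\<forall>s\<in>S. tracks D (F u) s p) \<longrightarrow> tracks D (Ex n) (\<pi> u) p)" by metis
  \<comment> \<open>Only finitely many \<open>u\<close> lie below \<open>M\<close>, so a single
    finite window, and hence a single \<delta>, handles all of them.\<close>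
  define F' where "F' = (\<Union>u\<in>{u\<in>V. u \<le> M}. F u)"
  have "finite F'" "F' \<subseteq> carrier G" using F G by (auto simp: F'_def)
  then obtain m where m: "F' \<subseteq> Ex m" using exhaustion_finite_subset[OF Ex] by blast
  show "\<exists>\<delta>>0. \<forall>p. pseudo_orbit D \<Sigma> valuation_action S (hamming_metric Ex) \<delta> p \<longrightarrow>
    (\<exists>x\<in>\<Sigma>. \<forall>\<tau>\<in>carrier D. hamming_metric Ex (valuation_action \<tau> x) (p \<tau>) < \<epsilon>)"
  proof (rule exI[of _ "1 / 2 ^ m"], intro conjI allI impI)
    fix p assume "pseudo_orbit D \<Sigma> valuation_action S (hamming_metric Ex) (1 / 2 ^ m) p"
    then have p: "p \<in> carrier D \<rightarrow> \<Sigma>"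
      and p_less: "\<forall>s\<in>S. \<forall>\<tau>\<in>carrier D.
        hamming_metric Ex (s (p \<tau>)) (p (s \<otimes>\<^bsub>D\<^esub> \<tau>)) < 1 / 2 ^ m"
      unfolding pseudo_orbit_def valuation_action_def by blast+
    have p_tracks: "tracks D F' s p" if "s \<in> S" for s
    proof (rule tracksI)
      fix \<tau> i assume "\<tau> \<in> carrier D" and i: "i \<in> F'"
      then have "hamming_metric Ex (s (p \<tau>)) (p (s \<otimes>\<^bsub>D\<^esub> \<tau>)) < 1 / 2 ^ m"
        using bspec[OF p_less that] by blast
      moreover have "i \<in> Ex m" using i m by blast
      ultimately show "s (p \<tau>) i = p (s \<otimes>\<^bsub>D\<^esub> \<tau>) i"
        using agree_if_hamming_metric_less Ex by metis
    qed
    \<comment> \<open>Finite type is applied to the family \<open>p (\<pi> u)\<close>; its local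
      solution at the translate by \<open>c\<close> is the pseudo-orbit point
      \<open>p (\<pi> c)\<close> itself.\<close>
    have "\<exists>x\<in>\<Sigma>. \<forall>u\<in>V. \<forall>i\<in>Ex n. \<pi> u x i = p (\<pi> u) i"
    proof (rule M, rule ballI)
      fix c assume c: "c \<in> V"
      have "\<pi> u (p (\<pi> c)) i = p (\<pi> (u * c)) i" if u: "u \<in> V" "u \<le> M" "i \<in> Ex n" for u i
      proof -
        have "F u \<subseteq> F'" using u by (auto simp: F'_def)
        then have "\<forall>s\<in>S. tracks D (F u) s p" using p_tracks tracks_mono[of D F'] by blast
        then have "tracks D (Ex n) (\<pi> u) p" using F[OF u(1)] p by blast
        then have "\<pi> u (p (\<pi> c)) i = p (\<pi> u \<otimes>\<^bsub>D\<^esub> \<pi> c) i"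
          by (rule tracksD[OF _ \<pi>(2)[OF c] u(3)])
        then show ?thesis using \<pi>(3)[OF u(1) c] by simp
      qed
      then show "\<exists>z\<in>\<Sigma>. \<forall>u\<in>V. u \<le> M \<longrightarrow> (\<forall>i\<in>Ex n. \<pi> u z i = p (\<pi> (u * c)) i)"
        using funcset_mem[OF p \<pi>(2)[OF c]] by (intro bexI[of _ "p (\<pi> c)"]) simp_all
    qed
    then obtain x where x: "x \<in> \<Sigma>" "\<And>u i. u \<in> V \<Longrightarrow> i \<in> Ex n \<Longrightarrow> \<pi> u x i = p (\<pi> u) i" by blast
    have "hamming_metric Ex (valuation_action \<tau> x) (p \<tau>) < \<epsilon>" if \<tau>: "\<tau> \<in> carrier D" for \<tau>
    proof -
      \<comment> \<open>Surjectivity of the coding transfers agreement from smooth numbers to every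
        element of the acting monoid.\<close>
      obtain u where u: "u \<in> V" "\<pi> u = \<tau>" using \<pi>(4)[OF \<tau>] by blast
      have "\<forall>i\<in>Ex n. \<tau> x i = p \<tau> i" using x(2)[OF u(1)] u(2) by simp
      then have "hamming_metric Ex (\<tau> x) (p \<tau>) \<le> 1 / 2 ^ n" by (rule hamming_metric_le)
      then show ?thesis using n by (simp add: valuation_action_def power_divide)
    qed
    then show "\<exists>x\<in>\<Sigma>. \<forall>\<tau>\<in>carrier D. hamming_metric Ex (valuation_action \<tau> x) (p \<tau>) < \<epsilon>"
      using x(1) by blast
  qed simp
qed

end

section \<open>From Artinian groups and modules to operator powers\<close>

lemma closedin_prodiscrete_memI:
  assumes closed: "closedin (prodiscrete_topology G A) \<Sigma>" and x: "x \<in> carrier G \<rightarrow>\<^sub>E A"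
    and approx: "\<And>F. finite F \<Longrightarrow> F \<subseteq> carrier G \<Longrightarrow> \<exists>z\<in>\<Sigma>. \<forall>g\<in>F. z g = x g"
  shows "x \<in> \<Sigma>"
proof (rule ccontr)
  assume "x \<notin> \<Sigma>"
  let ?T = "product_topology (\<lambda>_. discrete_topology A) (carrier G)"
  have "openin ?T (topspace ?T - \<Sigma>)"
    using closed by (simp add: closedin_def prodiscrete_topology_def)
  moreover have "x \<in> topspace ?T - \<Sigma>" using x \<open>x \<notin> \<Sigma>\<close> by simp
  \<comment> \<open>A basic neighbourhood constrains finitely many coordinates, so an approximant
    agreeing with \<open>x\<close> there lies in it, contradicting disjointness from
    \<Sigma>.\<close>
  ultimately obtain U where U: "finite {g \<in> carrier G. U g \<noteq> A}"
      "x \<in> Pi\<^sub>E (carrier G) U" "Pi\<^sub>E (carrier G) U \<subseteq> topspace ?T - \<Sigma>"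
    unfolding openin_product_topology_alt topspace_discrete_topology by blast
  obtain z where z: "z \<in> \<Sigma>" "\<forall>g\<in>{g \<in> carrier G. U g \<noteq> A}. z g = x g"
    using approx[OF U(1)] by blast
  have zA: "z \<in> carrier G \<rightarrow>\<^sub>E A"
    using closedin_subset[OF closed] z(1) by (auto simp: prodiscrete_topology_def)
  have "z \<in> Pi\<^sub>E (carrier G) U"
  proof (rule PiE_I)
    fix g assume g: "g \<in> carrier G"
    show "z g \<in> U g"
    proof (cases "U g = A")
      case True
      then show ?thesis using zA g by auto
    next
      case False
      then have "z g = x g" using z(2) g by blast
      then show ?thesis using U(2) g by auto
    qed
  qed (use zA in \<open>auto simp: PiE_def extensional_def\<close>)
  then show False using U(3) z(1) by blast
qed

text \<open>Groups are the case of an empty operator set; \<open>id\<close> indexed by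
  \<open>unit\<close> is a placeholder.\<close>

lemma operator_power_artinian_group:
  fixes G :: "('g, 'x) monoid_scheme" and A :: "('a, 'y) monoid_scheme"
  assumes "artinian_group A" "countable (carrier G)" "subgroup \<Sigma> (power_group G A)"
    "closedin (prodiscrete_topology G (carrier A)) \<Sigma>"
  shows "operator_power A {} (\<lambda>_ :: unit. id) (carrier G) \<Sigma>"
proof (rule operator_power.intro)
  show "group A" using assms(1) by (simp add: artinian_group_def)
  show "\<exists>N. \<forall>n\<ge>N. H n = H N" if "\<And>n. subgroup (H n) A" "decseq H" for H :: "nat \<Rightarrow> 'a set"
  proof -
    have "(\<forall>n. subgroup (H n) A) \<and> decseq H" using that by blast
    then show ?thesis
      by (rule mp[OF spec[OF conjunct2[OF assms(1)[unfolded artinian_group_def]]]])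
  qed
  show "subgroup \<Sigma> (product_group (carrier G) (\<lambda>_. A))"
    using assms(3) by (simp add: power_group_def)
  show "x \<in> \<Sigma>" if "x \<in> carrier G \<rightarrow>\<^sub>E carrier A"
    "\<And>F. finite F \<Longrightarrow> F \<subseteq> carrier G \<Longrightarrow> \<exists>z\<in>\<Sigma>. \<forall>i\<in>F. z i = x i" for x
    by (rule closedin_prodiscrete_memI[OF assms(4) that])
qed (use assms(2) in auto)

text \<open>Left and right modules share closure and additivity of each scalar, so both give
  operators.\<close>

lemma artinian_module_smult_hom:
  assumes "artinian_module R M" "r \<in> carrier R"
  shows "(\<lambda>x. r \<odot>\<^bsub>M\<^esub> x) \<in> hom (add_monoid M) (add_monoid M)"
proof -
  have "r \<odot>\<^bsub>M\<^esub> x \<in> carrier M \<and>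
      r \<odot>\<^bsub>M\<^esub> (x \<oplus>\<^bsub>M\<^esub> y) = r \<odot>\<^bsub>M\<^esub> x \<oplus>\<^bsub>M\<^esub> r \<odot>\<^bsub>M\<^esub> y"
    if "x \<in> carrier M" "y \<in> carrier M" for x y
    using assms that left_module.smult_closed[of R M r x] left_module.smult_r_distr[of R M r x y]
      right_module.smult_closed[of R M r x] right_module.smult_r_distr[of R M r x y]
    unfolding artinian_module_def by blast
  then show ?thesis by (simp add: hom_def)
qed

text \<open>With the scalars as operators on the additive group, the operator-stable subgroups are
  exactly the submodules, so the two chain conditions coincide.\<close>

lemma operator_power_artinian_module:
  fixes G :: "('g, 'x) monoid_scheme" and R :: "('r, 'z) ring_scheme"
    and M :: "('r, 'b, 'w) module_scheme"
  assumes art: "artinian_module R M" and "countable (carrier G)"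
    and sub: "submodule \<Sigma> R (power_module G M)"
    and closed: "closedin (prodiscrete_topology G (carrier M)) \<Sigma>"
  shows "operator_power (add_monoid M) (carrier R) (\<lambda>r x. r \<odot>\<^bsub>M\<^esub> x) (carrier G) \<Sigma>"
proof (rule operator_power.intro)
  have "abelian_group M"
    using art left_module.axioms(2) right_module.axioms(2) unfolding artinian_module_def by blast
  then show "group (add_monoid M)" by (rule abelian_group.a_group)
  show "(\<lambda>x. r \<odot>\<^bsub>M\<^esub> x) \<in> hom (add_monoid M) (add_monoid M)" if "r \<in> carrier R" for r
    by (rule artinian_module_smult_hom[OF art that])
  show "\<exists>N. \<forall>n\<ge>N. H n = H N" if "\<And>n. subgroup (H n) (add_monoid M)"
    "\<And>n r x. r \<in> carrier R \<Longrightarrow> x \<in> H n \<Longrightarrow> r \<odot>\<^bsub>M\<^esub> x \<in> H n" "decseq H" for H :: "nat \<Rightarrow> 'b set"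
  proof -
    have "submodule (H n) R M" for n
      using that(1,2) by (intro submodule.intro submodule_axioms.intro)
    then have "(\<forall>n. submodule (H n) R M) \<and> decseq H" using that(3) by blast
    then show ?thesis by (rule mp[OF spec[OF conjunct2[OF art[unfolded artinian_module_def]]]])
  qed
  have "subgroup \<Sigma> (add_monoid (power_module G M))" using sub by (rule submodule.axioms)
  \<comment> \<open>Both group structures have the same carrier, product and unit, and these
    determine inverses.\<close>
  then show "subgroup \<Sigma> (product_group (carrier G) (\<lambda>_. add_monoid M))"
    by (simp add: subgroup_def power_module_def product_group_def m_inv_def)
  show "(\<lambda>i\<in>carrier G. r \<odot>\<^bsub>M\<^esub> x i) \<in> \<Sigma>" if "r \<in> carrier R" "x \<in> \<Sigma>" for r x
    using submodule.smult_closed[OF sub that] by (simp add: power_module_def)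
  show "x \<in> \<Sigma>" if "x \<in> carrier G \<rightarrow>\<^sub>E carrier (add_monoid M)"
    "\<And>F. finite F \<Longrightarrow> F \<subseteq> carrier G \<Longrightarrow> \<exists>z\<in>\<Sigma>. \<forall>i\<in>F. z i = x i" for x
    by (rule closedin_prodiscrete_memI[OF closed that(1)[simplified] that(2)])
qed (use assms(2) in auto)

theorem corollary1p1:
  fixes G :: "('g, 'x) monoid_scheme"
    and A :: "('a, 'y) monoid_scheme"
    and R :: "('r, 'z) ring_scheme"
    and M :: "('r, 'b, 'w) module_scheme"
  assumes "monoid G" and "countable (carrier G)"
  shows
    "(\<forall>\<Sigma> \<Gamma>.
        artinian_group A \<and>
        subshift G (carrier A) \<Sigma> \<and>
        closedin (prodiscrete_topology G (carrier A)) \<Sigma> \<and>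
        subgroup \<Sigma> (power_group G A) \<and>
        submonoid \<Gamma> (group_End ((power_group G A)\<lparr>carrier := \<Sigma>\<rparr>)) \<and>
        comm_monoid (group_End ((power_group G A)\<lparr>carrier := \<Sigma>\<rparr>) \<lparr>carrier := \<Gamma>\<rparr>) \<and>
        finitely_generated_monoid (group_End ((power_group G A)\<lparr>carrier := \<Sigma>\<rparr>) \<lparr>carrier := \<Gamma>\<rparr>) \<and>
        (\<forall>\<tau>\<in>\<Gamma>. shift_equivariant G \<Sigma> \<tau> \<and> prodiscrete_uniformly_continuous G \<Sigma> \<tau>)
        \<longrightarrow> shadowing_property G (group_End ((power_group G A)\<lparr>carrier := \<Sigma>\<rparr>) \<lparr>carrier := \<Gamma>\<rparr>) \<Sigma>
              valuation_action)
     \<and>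
     (\<forall>\<Sigma> \<Gamma>.
        artinian_module R M \<and>
        subshift G (carrier M) \<Sigma> \<and>
        closedin (prodiscrete_topology G (carrier M)) \<Sigma> \<and>
        submodule \<Sigma> R (power_module G M) \<and>
        submonoid \<Gamma> (module_End R ((power_module G M)\<lparr>carrier := \<Sigma>\<rparr>)) \<and>
        comm_monoid (module_End R ((power_module G M)\<lparr>carrier := \<Sigma>\<rparr>) \<lparr>carrier := \<Gamma>\<rparr>) \<and>
        finitely_generated_monoid (module_End R ((power_module G M)\<lparr>carrier := \<Sigma>\<rparr>) \<lparr>carrier := \<Gamma>\<rparr>) \<and>
        (\<forall>\<tau>\<in>\<Gamma>. shift_equivariant G \<Sigma> \<tau> \<and> prodiscrete_uniformly_continuous G \<Sigma> \<tau>)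
        \<longrightarrow> shadowing_property G (module_End R ((power_module G M)\<lparr>carrier := \<Sigma>\<rparr>) \<lparr>carrier := \<Gamma>\<rparr>) \<Sigma>
              valuation_action)"
proof (intro conjI allI impI; elim conjE)
  fix \<Sigma> \<Gamma>
  assume art: "artinian_group A" and closed: "closedin (prodiscrete_topology G (carrier A)) \<Sigma>"
    and sub: "subgroup \<Sigma> (power_group G A)"
    and \<Gamma>: "submonoid \<Gamma> (group_End ((power_group G A)\<lparr>carrier := \<Sigma>\<rparr>))"
    and comm: "comm_monoid (group_End ((power_group G A)\<lparr>carrier := \<Sigma>\<rparr>) \<lparr>carrier := \<Gamma>\<rparr>)"
    and unif: "\<forall>\<tau>\<in>\<Gamma>. shift_equivariant G \<Sigma> \<tau> \<and> prodiscrete_uniformly_continuous G \<Sigma> \<tau>"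
  interpret operator_power A "{}" "\<lambda>_ :: unit. id" "carrier G" \<Sigma>
    by (rule operator_power_artinian_group[OF art assms(2) sub closed])
  have W: "(power_group G A)\<lparr>carrier := \<Sigma>\<rparr> = W" by (simp add: W_def power_group_def)
  show "shadowing_property G (group_End ((power_group G A)\<lparr>carrier := \<Sigma>\<rparr>) \<lparr>carrier := \<Gamma>\<rparr>) \<Sigma>
          valuation_action"
  proof (rule shadowing[OF refl _ comm])
    show "carrier (group_End ((power_group G A)\<lparr>carrier := \<Sigma>\<rparr>) \<lparr>carrier := \<Gamma>\<rparr>) \<subseteq> operator_endos"
      using submonoid.subset[OF \<Gamma>] by (auto simp: W group_End_def operator_endos_def)
  qed (use unif in \<open>simp_all add: group_End_def compose_eq\<close>)
next
  fix \<Sigma> \<Gamma>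
  assume art: "artinian_module R M" and closed: "closedin (prodiscrete_topology G (carrier M)) \<Sigma>"
    and sub: "submodule \<Sigma> R (power_module G M)"
    and \<Gamma>: "submonoid \<Gamma> (module_End R ((power_module G M)\<lparr>carrier := \<Sigma>\<rparr>))"
    and comm: "comm_monoid (module_End R ((power_module G M)\<lparr>carrier := \<Sigma>\<rparr>) \<lparr>carrier := \<Gamma>\<rparr>)"
    and unif: "\<forall>\<tau>\<in>\<Gamma>. shift_equivariant G \<Sigma> \<tau> \<and> prodiscrete_uniformly_continuous G \<Sigma> \<tau>"
  interpret operator_power "add_monoid M" "carrier R" "\<lambda>r x. r \<odot>\<^bsub>M\<^esub> x" "carrier G" \<Sigma>
    by (rule operator_power_artinian_module[OF art assms(2) sub closed])
  \<comment> \<open>Homomorphisms depend only on carrier and operation, so additive endomorphisms of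
    the submodule \<Sigma> are those of \<open>W\<close>, although the records differ.\<close>
  have hom_W: "hom (add_monoid ((power_module G M)\<lparr>carrier := \<Sigma>\<rparr>))
      (add_monoid ((power_module G M)\<lparr>carrier := \<Sigma>\<rparr>)) = hom W W"
    by (simp add: hom_def W_def power_module_def)
  show "shadowing_property G (module_End R ((power_module G M)\<lparr>carrier := \<Sigma>\<rparr>) \<lparr>carrier := \<Gamma>\<rparr>) \<Sigma>
          valuation_action"
  proof (rule shadowing[OF refl _ comm])
    show "carrier (module_End R ((power_module G M)\<lparr>carrier := \<Sigma>\<rparr>) \<lparr>carrier := \<Gamma>\<rparr>) \<subseteq> operator_endos"
    proof
      fix \<tau> assume "\<tau> \<in> carrier (module_End R ((power_module G M)\<lparr>carrier := \<Sigma>\<rparr>) \<lparr>carrier := \<Gamma>\<rparr>)"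
      then have \<tau>: "\<tau> \<in> carrier (module_End R ((power_module G M)\<lparr>carrier := \<Sigma>\<rparr>))"
        using submonoid.subset[OF \<Gamma>] by auto
      then have "\<tau> \<in> hom W W" unfolding hom_W[symmetric] module_End_def by simp
      moreover have "\<forall>r\<in>carrier R. \<forall>x\<in>\<Sigma>. \<tau> (pact r x) = pact r (\<tau> x)"
        using \<tau> by (simp add: module_End_def pact_def power_module_def)
      ultimately show "\<tau> \<in> operator_endos" by (simp add: operator_endos_def)
    qed
  qed (use unif in \<open>simp_all add: module_End_def compose_eq\<close>)
qed

end
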